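(* Let $V_j$ be vector spaces for $j\in D$, let $T_D$ be a dimension partition tree of $D$, let $\mathfrak r=(r_\alpha)_{\alpha\in T_D}\in\mathbb N^{T_D}$ and $\mathbf v\in\mathbf V_D$. Then the following two statements are equivalent. (a) $\mathbf v\in\mathcal{FT}_{\mathfrak r}(\mathbf V_D)$. (b) There exists a basis $\{u^{(k)}_{i_k}:1\le i_k\le r_k\}$ of $U_k^{\min}(\mathbf v)$ for $k\in\mathcal L(T_D)$, where for each $\mu\in T_D\setminus\mathcal L(T_D)$ there exists a unique $C^{(\mu)}\in\mathbb R_*^{r_\mu\times(\times_{\beta\in S(\mu)}r_\beta)}$ such that the set $\{\mathbf u^{(\mu)}_{i_\mu}:1\le i_\mu\le r_\mu\}$, with $$\mathbf u^{(\mu)}_{i_\mu}=\sum_{\substack{1\le i_\beta\le r_\beta\\ \beta\in S(\mu)}}C^{(\mu)}_{i_\mu,(i_\beta)_{\beta\in S(\mu)}}\bigotimes_{\beta\in S(\mu)}\mathbf u^{(\beta)}_{i_\beta}\qquad(1\le i_\mu\le r_\mu),$$ is a basis of $U_\mu^{\min}(\mathbf v)$, and $$\mathbf v=\sum_{\substack{1\le i_\alpha\le r_\alpha\\ \alpha\in S(D)}}C^{(D)}_{(i_\alpha)_{\alpha\in S(D)}}\bigotimes_{\alpha\in S(D)}\mathbf u^{(\alpha)}_{i_\alpha}.\qquad( * )$$ Furthermore, if $\mathbf v\in\mathcal{FT}_{\mathfrak r}(\mathbf V_D)$, then $( * )$ can be written for each $\alpha\in S(D)$ as $$\mathbf v=\sum_{1\le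 i_\alpha\le r_\alpha}\mathbf u^{(\alpha)}_{i_\alpha}\otimes\mathbf U^{(\alpha)}_{i_\alpha},$$ where $U^{\min}_{S(D)\setminus\{\alpha\}}(\mathbf v)=\mathrm{span}\{\mathbf U^{(\alpha)}_{i_\alpha}:1\le i_\alpha\le r_\alpha\}$, and for each $\mu\in T_D\setminus\mathcal L(T_D)$ and $\beta\in S(\mu)$ we have $$\mathbf u^{(\mu)}_{i_\mu}=\sum_{1\le i_\beta\le r_\beta}\mathbf u^{(\beta)}_{i_\beta}\otimes\mathbf U^{(\beta)}_{i_\mu,i_\beta},\qquad \mathbf U^{(\beta)}_{i_\mu,i_\beta}:=\sum_{\substack{1\le i_\delta\le r_\delta\\ \delta\in S(\mu),\ \delta\ne\beta}}C^{(\mu)}_{i_\mu,(i_\delta)_{\delta\in S(\mu)}}\bigotimes_{\substack{\delta\in S(\mu)\\ \delta\neq\beta}}\mathbf u^{(\delta)}_{i_\delta},$$ and $U^{\min}_{S(\mu)\setminus\{\beta\}}(\mathbf v)=U^{\min}_{S(\mu)\setminus\{\beta\}}(\mathbf u^{(\mu)}_{i_\mu})=\mathrm{span}\{\mathbf U^{(\beta)}_{i_\mu,i_\beta}:1\le i_\beta\le r_\beta\}$ for $1\le i_\mu\le r_\mu$.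
   Context: $D=\{1,\dots,d\}$ is a finite index set, the $V_j$ are real vector spaces, and for $\emptyset\ne\alpha\subset D$, $\mathbf V_\alpha={}_a\bigotimes_{j\in\alpha}V_j$ is the algebraic tensor product ($\mathbf V_{\{j\}}=V_j$). Tensor products over disjoint index sets are identified regardless of the order of the factors. A dimension partition tree $T_D$ of $D$ is a rooted tree whose vertices are non-empty subsets of $D$, with root $D$, such that every vertex $\alpha$ with $\#\alpha\ge2$ has at least two sons and its set of sons $S(\alpha)$ is a partition of $\alpha$, and every vertex with $\#\alpha=1$ has no sons. $\mathcal L(T_D)$ is the set of leaves; it equals $\{\{j\}:j\in D\}$ and $\{j\}$ is also written $j$. Minimal subspaces: for a partition $D=\bigcup_{i=1}^m\alpha_i$ into non-empty disjoint sets and $\mathbf v\in\mathbf V_D={}_a\bigotimes_i\mathbf V_{\alpha_i}$, the subspaces $U^{\min}_{\alpha_i}(\mathbf v)\subset\mathbf V_{\alpha_i}$ are determined by: $\mathbf v\in{}_a\bigotimes_iU^{\min}_{\alpha_i}(\mathbf v)$, and $\mathbf v\in{}_a\bigotimes_i\mathbf U_{\alpha_i}$ with subspaces $\mathbf U_{\alpha_i}\subset\mathbf V_{\alpha_i}$ implies $U^{\min}_{\alpha_i}(\mathbf v)\subset\mathbf U_{\alpha_i}$. They depend only on $\alpha_i$ and $\mathbf v$. Put $U_D^{\min}(\mathbf v)=\mathrm{span}\{\mathbf v\}$. $U^{\min}_{S(\mu)\setminus\{\beta\}}(\mathbf v)$ denotes the minimal subspace of $\mathbf v$ in ${}_a\bigotimes_{\delta\in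 S(\mu)\setminus\{\beta\}}\mathbf V_\delta$; for $\mathbf u\in\mathbf V_\mu$, $U^{\min}_{S(\mu)\setminus\{\beta\}}(\mathbf u)$ is the analogous minimal subspace of $\mathbf u$ with respect to $\mathbf V_\mu=\mathbf V_\beta\otimes_a({}_a\bigotimes_{\delta\in S(\mu)\setminus\{\beta\}}\mathbf V_\delta)$. $\mathcal{FT}_{\mathfrak r}(\mathbf V_D)=\{\mathbf v\in\mathbf V_D:\dim U_\alpha^{\min}(\mathbf v)=r_\alpha\text{ for all }\alpha\in T_D\}$. It is empty for inadmissible $\mathfrak r$; admissible $\mathfrak r$ (i.e. realised by some $\mathbf v\neq\mathbf 0$) have $r_D=1$, and then the index $i_D=1$ is suppressed in $C^{(D)}$ and $\mathbf u^{(D)}_1=\mathbf v$. For a real coefficient tensor $C$ with finitely many index directions $\mu\in\alpha$ of sizes $r_\mu$, $\mathcal M_\mu(C)$ is the matrix with row index $i_\mu$ (size $r_\mu$) and column index the remaining indices. $\mathbb R_*^{\times_{\mu\in\alpha}r_\mu}$ is the set of those $C\in\mathbb R^{\times_{\mu\in\alpha}r_\mu}$ for which every $\mathcal M_\mu(C)$, $\mu\in\alpha$, has maximal rank. For $C^{(\mu)}\in\mathbb R_*^{r_\mu\times(\times_{\beta\in S(\mu)}r_\beta)}$ the index directions are $\mu$ and all $\beta\in S(\mu)$. For a leaf $\beta=\{k\}$, $\mathbf u^{(\beta)}_{i_\beta}=u^{(k)}_{i_k}$.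
   Formalization: The last chain fails for r_μ≥2; proved instead: U^min_{S(μ)∖β}(v) is the span over all i_μ of the U^min_{S(μ)∖β}(u^(μ)_{i_μ}), each being span{U^(β)_{i_μ,i_β}: i_β}. C^(μ) is unique relative to the chosen basis u^(μ), since it can otherwise be rescaled. *)

theory Defs
  imports "HOL-Analysis.Analysis" "HOL-Library.Function_Algebras" "HOL-Library.Disjoint_Sets"
begin

section \<open>Real-valued functions as a real vector space\<close>

text \<open>\<open>Function_Algebras\<close> provides the pointwise ring structure on functions; the
  pointwise scalar multiplication is added here.\<close>

instantiation "fun" :: (type, real_vector) real_vector
begin

definition scaleR_fun :: "real \<Rightarrow> ('a \<Rightarrow> 'b) \<Rightarrow> 'a \<Rightarrow> 'b"
  where "scaleR_fun c f = (\<lambda>x. c *\<^sub>R f x)"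

instance
  by standard (simp_all add: scaleR_fun_def fun_eq_iff scaleR_add_right scaleR_add_left)

end

section \<open>Algebraic tensor products\<close>

typedef (overloaded) 'a dual = "{f :: 'a::real_vector \<Rightarrow> real. linear f}"
  morphisms dual_apply Abs_dual
  by (rule exI[of _ "\<lambda>_. 0"]) (simp add: linear_iff)

text \<open>
  Given real vector spaces \<open>V j\<close>, all of them subspaces of one ambient space \<open>'a\<close> (no
  restriction: take the direct sum), the elementary tensor of vectors \<open>x j \<in> V j\<close>,
  \<open>j \<in> \<alpha>\<close>, is represented by the function mapping a family \<open>\<phi>\<close> of linear functionals to
  \<open>\<Prod>j\<in>\<alpha>. \<phi> j (x j)\<close>, and the algebraic tensor product over \<open>\<alpha>\<close> is the span of the
  elementary tensors.  Lemmas \<open>multilinear_on_elementary_tensor\<close>, \<open>tensor_space_universal\<close> and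
  \<open>tensor_space_universal_unique\<close> below give its universal property.

  In this model the product of tensors over disjoint index sets is the pointwise product of
  functions, so the canonical isomorphisms between tensor products that differ in the grouping or
  the order of the factors become equalities.  For \<open>\<alpha> = {j}\<close> the space is the isomorphic
  image of \<open>V j\<close> under \<open>x \<mapsto> (\<lambda>\<phi>. \<phi> j x)\<close>.
\<close>

type_synonym ('i, 'a) tensor = "('i \<Rightarrow> 'a dual) \<Rightarrow> real"

definition elementary_tensor :: "'i set \<Rightarrow> ('i \<Rightarrow> 'a::real_vector) \<Rightarrow> ('i, 'a) tensor"
  where "elementary_tensor \<alpha> x = (\<lambda>\<phi>. \<Prod>j\<in>\<alpha>. dual_apply (\<phi> j) (x j))"

definition tensor_space :: "('i \<Rightarrow> 'a::real_vector set) \<Rightarrow> 'i set \<Rightarrow> ('i, 'a) tensor set"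
  where "tensor_space V \<alpha> = span {elementary_tensor \<alpha> x | x. \<forall>j\<in>\<alpha>. x j \<in> V j}"

text \<open>The following two operations are tensor products only for factors over pairwise disjoint
  index sets; they are used in no other case.\<close>

definition tensor_times ::
    "('i, 'a::real_vector) tensor \<Rightarrow> ('i, 'a) tensor \<Rightarrow> ('i, 'a) tensor" (infixl "\<otimes>\<^sub>t" 70)
  where "s \<otimes>\<^sub>t t = (\<lambda>\<phi>. s \<phi> * t \<phi>)"

definition tensor_prod ::
    "'i set set \<Rightarrow> ('i set \<Rightarrow> ('i, 'a::real_vector) tensor) \<Rightarrow> ('i, 'a) tensor"
  where "tensor_prod P t = (\<lambda>\<phi>. \<Prod>\<beta>\<in>P. t \<beta> \<phi>)"

text \<open>The algebraic tensor product of subspaces \<open>U \<beta>\<close>, \<open>\<beta> \<in> P\<close>.\<close>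

definition tensor_prod_subspaces ::
    "'i set set \<Rightarrow> ('i set \<Rightarrow> ('i, 'a::real_vector) tensor set) \<Rightarrow> ('i, 'a) tensor set"
  where "tensor_prod_subspaces P U = span {tensor_prod P t | t. \<forall>\<beta>\<in>P. t \<beta> \<in> U \<beta>}"

subsection \<open>The universal property\<close>

definition multilinear_on ::
    "'i set \<Rightarrow> ('i \<Rightarrow> 'a::real_vector set) \<Rightarrow> (('i \<Rightarrow> 'a) \<Rightarrow> 'b::real_vector) \<Rightarrow> bool"
  where "multilinear_on \<alpha> V f \<longleftrightarrow>
    (\<forall>x y. (\<forall>j\<in>\<alpha>. x j = y j) \<longrightarrow> f x = f y) \<and>
    (\<forall>x. (\<forall>j\<in>\<alpha>. x j \<in> V j) \<longrightarrow> (\<forall>j\<in>\<alpha>. \<forall>y\<in>V j. \<forall>z\<in>V j. \<forall>c.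
      f (x(j := y + z)) = f (x(j := y)) + f (x(j := z)) \<and>
      f (x(j := c *\<^sub>R y)) = c *\<^sub>R f (x(j := y))))"

lemma linear_dual_apply: "linear (dual_apply \<phi>)"
  using dual_apply[of \<phi>] unfolding mem_Collect_eq .

lemma sum_fun_apply: "(\<Sum>i\<in>A. f i) x = (\<Sum>i\<in>A. f i x)"
  for f :: "'k \<Rightarrow> 'b \<Rightarrow> 'c::comm_monoid_add"
proof (induction A rule: infinite_finite_induct)
  case (infinite A)
  then show ?case by (simp only: sum.infinite zero_fun_apply not_False_eq_True)
next
  case empty
  show ?case by (simp only: sum.empty zero_fun_apply)
next
  case (insert i A)
  then show ?case by (simp only: sum.insert plus_fun_apply not_False_eq_True)
qed

lemma multilinear_on_elementary_tensor:
  assumes "finite \<alpha>"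
  shows "multilinear_on \<alpha> V (elementary_tensor \<alpha>)"
proof -
  have upd: "elementary_tensor \<alpha> (x(j := y)) \<phi> =
      dual_apply (\<phi> j) y * (\<Prod>i\<in>\<alpha>-{j}. dual_apply (\<phi> i) (x i))"
    if "j \<in> \<alpha>" for x j y \<phi>
    using assms that unfolding elementary_tensor_def
    by (subst prod.remove[of _ j]) (auto intro!: prod.cong)
  show ?thesis
    unfolding multilinear_on_def
    by (auto simp: fun_eq_iff upd scaleR_fun_def linear_add[OF linear_dual_apply]
        linear_scale[OF linear_dual_apply] algebra_simps)
      (auto simp: elementary_tensor_def intro!: prod.cong)
qed

lemma multilinear_on_sum:
  assumes "multilinear_on \<alpha> V f" "\<And>j. j \<in> \<alpha> \<Longrightarrow> subspace (V j)" "\<And>i. i \<in> \<alpha> \<Longrightarrow> x i \<in> V i" "j \<in> \<alpha>"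
    "finite M" "\<And>m. m \<in> M \<Longrightarrow> b m \<in> V j"
  shows "f (x(j := (\<Sum>m\<in>M. c m *\<^sub>R b m))) = (\<Sum>m\<in>M. c m *\<^sub>R f (x(j := b m)))"
  using assms(5,6)
proof (induction M rule: finite_induct)
  case empty
  have "f (x(j := 0 *\<^sub>R 0)) = 0 *\<^sub>R f (x(j := 0))"
    using assms(1-4) unfolding multilinear_on_def by (meson subspace_0)
  then show ?case by (simp add: fun_upd_def)
next
  case (insert m M)
  have 1: "(\<Sum>m\<in>M. c m *\<^sub>R b m) \<in> V j" and 2: "c m *\<^sub>R b m \<in> V j" and 3: "b m \<in> V j"
    using insert.prems assms(2,4) by (auto intro!: subspace_sum subspace_scale)
  have "f (x(j := c m *\<^sub>R b m + (\<Sum>m\<in>M. c m *\<^sub>R b m))) =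
      f (x(j := c m *\<^sub>R b m)) + f (x(j := (\<Sum>m\<in>M. c m *\<^sub>R b m)))"
    using assms(1,3,4) 1 2 unfolding multilinear_on_def by blast
  moreover have "f (x(j := c m *\<^sub>R b m)) = c m *\<^sub>R f (x(j := b m))"
    using assms(1,3,4) 3 unfolding multilinear_on_def by blast
  ultimately show ?case using insert by (simp add: fun_upd_def)
qed

lemma multilinear_on_expand:
  assumes f: "multilinear_on \<alpha> V f" and V: "\<And>j. j \<in> \<alpha> \<Longrightarrow> subspace (V j)" and fin: "finite \<alpha>"
    and B: "\<And>j. j \<in> \<alpha> \<Longrightarrow> finite (B j)" "\<And>j. j \<in> \<alpha> \<Longrightarrow> B j \<subseteq> V j"
    and x: "\<And>j. j \<in> \<alpha> \<Longrightarrow> x j = (\<Sum>b\<in>B j. \<psi> j b (x j) *\<^sub>R b)"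
    and J: "J \<subseteq> \<alpha>"
  shows "f x = (\<Sum>m\<in>Pi\<^sub>E J B. (\<Prod>j\<in>J. \<psi> j (m j) (x j)) *\<^sub>R f (\<lambda>j. if j \<in> J then m j else x j))"
  using finite_subset[OF J fin] J
proof (induction J rule: finite_induct)
  case empty
  then show ?case by simp
next
  case (insert k J)
  have k: "k \<in> \<alpha>" and J: "J \<subseteq> \<alpha>" using insert.prems by auto
  have xV: "x j \<in> V j" if "j \<in> \<alpha>" for j
    using that B V by (subst x) (auto intro!: subspace_sum subspace_scale)
  have step: "f (\<lambda>j. if j \<in> J then m j else x j) =
      (\<Sum>b\<in>B k. \<psi> k b (x k) *\<^sub>R f (\<lambda>j. if j \<in> insert k J then (m(k := b)) j else x j))"
    if m: "m \<in> Pi\<^sub>E J B" for m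
  proof -
    let ?y = "\<lambda>j. if j \<in> J then m j else x j"
    have "?y k = x k" using insert.hyps by simp
    also have "x k = (\<Sum>b\<in>B k. \<psi> k b (x k) *\<^sub>R b)" by (rule x[OF k])
    finally have "f ?y = f (?y(k := (\<Sum>b\<in>B k. \<psi> k b (x k) *\<^sub>R b)))"
      by (rule arg_cong[where f = f, OF fun_upd_idem, symmetric])
    also have "\<dots> = (\<Sum>b\<in>B k. \<psi> k b (x k) *\<^sub>R f (?y(k := b)))"
    proof (rule multilinear_on_sum[OF f V])
      show "?y j \<in> V j" if "j \<in> \<alpha>" for j
        using that m B(2)[of j] xV[of j] by (auto simp: PiE_iff)
    qed (use k B in auto)
    also have "\<dots> = (\<Sum>b\<in>B k. \<psi> k b (x k) *\<^sub>R
        f (\<lambda>j. if j \<in> insert k J then (m(k := b)) j else x j))"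
      by (intro sum.cong refl arg_cong2[where f = scaleR] arg_cong[where f = f]) auto
    finally show ?thesis .
  qed
  have "f x = (\<Sum>m\<in>Pi\<^sub>E J B. (\<Prod>j\<in>J. \<psi> j (m j) (x j)) *\<^sub>R f (\<lambda>j. if j \<in> J then m j else x j))"
    using insert.IH[OF J] .
  also have "\<dots> = (\<Sum>m\<in>Pi\<^sub>E J B. \<Sum>b\<in>B k. (\<Prod>j\<in>insert k J. \<psi> j ((m(k := b)) j) (x j)) *\<^sub>R
      f (\<lambda>j. if j \<in> insert k J then (m(k := b)) j else x j))"
  proof (intro sum.cong refl)
    fix m assume m: "m \<in> Pi\<^sub>E J B"
    have p: "(\<Prod>j\<in>insert k J. \<psi> j ((m(k := b)) j) (x j)) =
        (\<Prod>j\<in>J. \<psi> j (m j) (x j)) * \<psi> k b (x k)" for b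
    proof -
      have "(\<Prod>j\<in>J. \<psi> j ((m(k := b)) j) (x j)) = (\<Prod>j\<in>J. \<psi> j (m j) (x j))"
        using insert.hyps by (intro prod.cong) auto
      then show ?thesis using insert.hyps by simp
    qed
    show "(\<Prod>j\<in>J. \<psi> j (m j) (x j)) *\<^sub>R f (\<lambda>j. if j \<in> J then m j else x j) =
      (\<Sum>b\<in>B k. (\<Prod>j\<in>insert k J. \<psi> j ((m(k := b)) j) (x j)) *\<^sub>R
      f (\<lambda>j. if j \<in> insert k J then (m(k := b)) j else x j))"
      unfolding p step[OF m] scaleR_sum_right scaleR_scaleR ..
  qed
  also have "\<dots> = (\<Sum>(b, m)\<in>B k \<times> Pi\<^sub>E J B. (\<Prod>j\<in>insert k J. \<psi> j ((m(k := b)) j) (x j)) *\<^sub>R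
      f (\<lambda>j. if j \<in> insert k J then (m(k := b)) j else x j))"
    by (subst sum.swap) (simp add: sum.cartesian_product)
  also have "\<dots> = (\<Sum>m\<in>Pi\<^sub>E (insert k J) B. (\<Prod>j\<in>insert k J. \<psi> j (m j) (x j)) *\<^sub>R
      f (\<lambda>j. if j \<in> insert k J then m j else x j))"
    unfolding PiE_insert_eq sum.reindex[OF inj_combinator[OF insert.hyps(2)]]
    by (simp add: case_prod_unfold)
  finally show ?case .
qed

lemma elementary_tensor_relation:
  fixes V :: "'i \<Rightarrow> 'a::real_vector set" and f :: "('i \<Rightarrow> 'a) \<Rightarrow> 'b::real_vector"
  assumes f: "multilinear_on \<alpha> V f" and V: "\<And>j. j \<in> \<alpha> \<Longrightarrow> subspace (V j)" and fin: "finite \<alpha>"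
    and K: "finite K" "\<And>x j. x \<in> K \<Longrightarrow> j \<in> \<alpha> \<Longrightarrow> x j \<in> V j"
    and 0: "(\<Sum>x\<in>K. c x *\<^sub>R elementary_tensor \<alpha> x) = 0"
  shows "(\<Sum>x\<in>K. c x *\<^sub>R f x) = 0"
proof -
  have "\<exists>B. B \<subseteq> (\<lambda>x. x j) ` K \<and> independent B \<and> (\<lambda>x. x j) ` K \<subseteq> span B" for j
    by (meson maximal_independent_subset)
  then obtain B where B: "\<And>j. B j \<subseteq> (\<lambda>x. x j) ` K" "\<And>j. independent (B j)"
    "\<And>j. (\<lambda>x. x j) ` K \<subseteq> span (B j)"
    by metis
  have finB: "finite (B j)" for j using B(1) K(1) by (meson finite_imageI finite_subset)
  have BV: "B j \<subseteq> V j" if "j \<in> \<alpha>" for j using B(1)[of j] K(2) that by auto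
  have "\<exists>\<phi>::'a dual. \<forall>b'\<in>B j. dual_apply \<phi> b' = (if b' = b then 1 else 0)" for j b
  proof -
    obtain g :: "'a \<Rightarrow> real" where "linear g" "\<forall>b'\<in>B j. g b' = (if b' = b then 1 else 0)"
      using linear_independent_extend[OF B(2)[of j], of "\<lambda>b'. if b' = b then 1 else 0"] by blast
    then show ?thesis by (intro exI[of _ "Abs_dual g"]) (simp add: Abs_dual_inverse)
  qed
  then obtain \<psi> :: "'i \<Rightarrow> 'a \<Rightarrow> 'a dual" where
    \<psi>: "\<And>j b b'. b' \<in> B j \<Longrightarrow> dual_apply (\<psi> j b) b' = (if b' = b then 1 else 0)"
    by metis
  have ex: "y = (\<Sum>b\<in>B j. dual_apply (\<psi> j b) y *\<^sub>R b)" if y: "y \<in> span (B j)" for y j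
  proof -
    obtain u where u: "y = (\<Sum>b\<in>B j. u b *\<^sub>R b)"
      using y unfolding span_finite[OF finB] by auto
    have "dual_apply (\<psi> j b) y = u b" if "b \<in> B j" for b
    proof -
      have "dual_apply (\<psi> j b) y = (\<Sum>b'\<in>B j. u b' * dual_apply (\<psi> j b) b')"
        unfolding u by (simp add: linear_sum[OF linear_dual_apply] linear_scale[OF linear_dual_apply])
      also have "\<dots> = (\<Sum>b'\<in>B j. if b' = b then u b' else 0)"
        by (intro sum.cong) (auto simp: \<psi>)
      finally show ?thesis using that finB by simp
    qed
    then show ?thesis using u by simp
  qed
  have "f x = (\<Sum>m\<in>Pi\<^sub>E \<alpha> B. elementary_tensor \<alpha> x (\<lambda>j. \<psi> j (m j)) *\<^sub>R f m)" if x: "x \<in> K" for x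
  proof -
    have "f x = (\<Sum>m\<in>Pi\<^sub>E \<alpha> B. (\<Prod>j\<in>\<alpha>. dual_apply (\<psi> j (m j)) (x j)) *\<^sub>R
        f (\<lambda>j. if j \<in> \<alpha> then m j else x j))"
      using B(3) x
      by (intro multilinear_on_expand[where \<psi> = "\<lambda>j b. dual_apply (\<psi> j b)",
            OF f V fin finB BV ex])
        auto
    moreover have "f (\<lambda>j. if j \<in> \<alpha> then m j else x j) = f m" for m
      using f[unfolded multilinear_on_def, THEN conjunct1, rule_format,
          of "\<lambda>j. if j \<in> \<alpha> then m j else x j" m] by simp
    ultimately show ?thesis by (simp add: elementary_tensor_def)
  qed
  then have "(\<Sum>x\<in>K. c x *\<^sub>R f x) =
      (\<Sum>x\<in>K. \<Sum>m\<in>Pi\<^sub>E \<alpha> B. (c x * elementary_tensor \<alpha> x (\<lambda>j. \<psi> j (m j))) *\<^sub>R f m)"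
    by (simp add: scaleR_sum_right)
  also have "\<dots> = (\<Sum>m\<in>Pi\<^sub>E \<alpha> B. (\<Sum>x\<in>K. c x *\<^sub>R elementary_tensor \<alpha> x) (\<lambda>j. \<psi> j (m j)) *\<^sub>R f m)"
    by (subst sum.swap) (simp add: sum_fun_apply scaleR_fun_def scaleR_sum_left)
  finally show ?thesis using 0 by simp
qed

lemma sum_relation_aux:
  fixes F :: "'x \<Rightarrow> 'z::real_vector"
  assumes "finite b" "inj_on s b" "x \<notin> s ` b"
  shows "(\<Sum>y\<in>insert x (s ` b). (if y = x then -1 else u (the_inv_into b s y)) *\<^sub>R F y) =
    (\<Sum>a\<in>b. u a *\<^sub>R F (s a)) - F x"
proof -
  have 1: "(\<Sum>y\<in>s ` b. (if y = x then -1 else u (the_inv_into b s y)) *\<^sub>R F y) =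
      (\<Sum>a\<in>b. u a *\<^sub>R F (s a))"
  proof -
    have "(if s a = x then -1 else u (the_inv_into b s (s a))) = u a" if "a \<in> b" for a
      using that assms(3) by (auto simp: the_inv_into_f_f[OF assms(2)])
    then show ?thesis
      by (simp only: sum.reindex[OF assms(2)] o_def cong: sum.cong)
  qed
  have "finite (s ` b)" using assms(1) by (rule finite_imageI)
  then show ?thesis unfolding sum.insert[OF \<open>finite (s ` b)\<close> assms(3)] 1 by simp
qed

theorem tensor_space_universal:
  fixes V :: "'i \<Rightarrow> 'a::real_vector set" and f :: "('i \<Rightarrow> 'a) \<Rightarrow> 'b::real_vector"
  assumes "finite \<alpha>" "\<And>j. j \<in> \<alpha> \<Longrightarrow> subspace (V j)" "multilinear_on \<alpha> V f"
  shows "\<exists>g. linear g \<and> (\<forall>x. (\<forall>j\<in>\<alpha>. x j \<in> V j) \<longrightarrow> g (elementary_tensor \<alpha> x) = f x)"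
proof -
  define X where "X = {x. \<forall>j\<in>\<alpha>. x j \<in> V j}"
  obtain B where B: "B \<subseteq> elementary_tensor \<alpha> ` X" "independent B"
    "elementary_tensor \<alpha> ` X \<subseteq> span B"
    by (rule maximal_independent_subset)
  have "\<forall>b\<in>B. \<exists>x. x \<in> X \<and> elementary_tensor \<alpha> x = b" using B(1) by auto
  then obtain s where s: "\<forall>b\<in>B. s b \<in> X \<and> elementary_tensor \<alpha> (s b) = b"
    by (rule bchoice[THEN exE])
  obtain g where g: "linear g" "\<forall>b\<in>B. g b = f (s b)"
    using linear_independent_extend[OF B(2), of "\<lambda>b. f (s b)"] by auto
  have "g (elementary_tensor \<alpha> x) = f x" if x: "x \<in> X" for x
  proof -
    have "elementary_tensor \<alpha> x \<in> span B" using B(3) x by auto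
    then obtain b u where b: "finite b" "b \<subseteq> B" "elementary_tensor \<alpha> x = (\<Sum>a\<in>b. u a *\<^sub>R a)"
      unfolding span_explicit mem_Collect_eq by (elim exE conjE) (rule that)
    have gx: "g (elementary_tensor \<alpha> x) = (\<Sum>a\<in>b. u a *\<^sub>R f (s a))"
    proof -
      have "g (elementary_tensor \<alpha> x) = (\<Sum>a\<in>b. u a *\<^sub>R g a)"
        unfolding b(3) using g(1) by (simp only: linear_sum linear_scale)
      also have "\<dots> = (\<Sum>a\<in>b. u a *\<^sub>R f (s a))"
        using g(2) b(2) by (intro sum.cong) auto
      finally show ?thesis .
    qed
    have ea: "(\<Sum>a\<in>b. u a *\<^sub>R elementary_tensor \<alpha> (s a)) = elementary_tensor \<alpha> x"
      unfolding b(3) using s b(2) by (intro sum.cong) auto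
    have inj: "inj_on s b"
    proof (rule inj_on_inverseI)
      show "elementary_tensor \<alpha> (s a) = a" if "a \<in> b" for a using s b(2) that by auto
    qed
    show ?thesis
    proof (cases "x \<in> s ` b")
      case True
      then have "elementary_tensor \<alpha> x \<in> B \<and> s (elementary_tensor \<alpha> x) = x" using s b(2) by auto
      then show ?thesis using g(2) by auto
    next
      case False
      have "(\<Sum>y\<in>insert x (s ` b). (if y = x then -1 else u (the_inv_into b s y)) *\<^sub>R f y) = 0"
      proof (rule elementary_tensor_relation[OF assms(3,2,1)])
        show "finite (insert x (s ` b))" using b(1) by simp
        show "y j \<in> V j" if "y \<in> insert x (s ` b)" "j \<in> \<alpha>" for y j
          using that x s b(2) unfolding X_def by auto
        show "(\<Sum>y\<in>insert x (s ` b). (if y = x then -1 else u (the_inv_into b s y)) *\<^sub>R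
            elementary_tensor \<alpha> y) = 0"
          unfolding sum_relation_aux[OF b(1) inj False] ea by (rule diff_self)
      qed
      then show ?thesis
        unfolding sum_relation_aux[OF b(1) inj False] gx by (simp only: right_minus_eq)
    qed
  qed
  then show ?thesis using g(1) unfolding X_def by auto
qed

lemma tensor_space_universal_unique:
  assumes "linear g" "linear h"
    and "\<And>x. (\<forall>j\<in>\<alpha>. x j \<in> V j) \<Longrightarrow> g (elementary_tensor \<alpha> x) = h (elementary_tensor \<alpha> x)"
    and "t \<in> tensor_space V \<alpha>"
  shows "g t = h t"
proof (rule linear_eq_on_span[OF assms(1,2)])
  let ?E = "{elementary_tensor \<alpha> x | x. \<forall>j\<in>\<alpha>. x j \<in> V j}"
  show "t \<in> span ?E"
    using assms(4) unfolding tensor_space_def .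
  fix e assume "e \<in> ?E"
  then show "g e = h e" using assms(3) by blast
qed

subsection \<open>Grouping the factors\<close>

lemma tensor_prod_insert:
  assumes "finite P" "\<beta> \<notin> P"
  shows "tensor_prod (insert \<beta> P) t = t \<beta> \<otimes>\<^sub>t tensor_prod P t"
  using assms by (simp add: tensor_prod_def tensor_times_def)

lemma tensor_times_span:
  assumes "s \<in> span A" "t \<in> span B"
  shows "s \<otimes>\<^sub>t t \<in> span {a \<otimes>\<^sub>t b | a b. a \<in> A \<and> b \<in> B}"
  using assms(1)
proof (induction rule: span_induct_alt)
  case base
  have "0 \<otimes>\<^sub>t t = 0" by (simp add: tensor_times_def fun_eq_iff)
  then show ?case by (simp only: span_zero)
next
  case (step c a y)
  have "a \<otimes>\<^sub>t t \<in> span {a \<otimes>\<^sub>t b | a b. a \<in> A \<and> b \<in> B}"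
    using assms(2)
  proof (induction rule: span_induct_alt)
    case base
    have "a \<otimes>\<^sub>t 0 = 0" by (simp add: tensor_times_def fun_eq_iff)
    then show ?case by (simp only: span_zero)
  next
    case (step c b y)
    have eq: "a \<otimes>\<^sub>t (c *\<^sub>R b + y) = c *\<^sub>R (a \<otimes>\<^sub>t b) + a \<otimes>\<^sub>t y"
      by (simp add: tensor_times_def fun_eq_iff scaleR_fun_def algebra_simps)
    have "a \<otimes>\<^sub>t b \<in> {a \<otimes>\<^sub>t b | a b. a \<in> A \<and> b \<in> B}"
      using step.hyps(1) \<open>a \<in> A\<close> by blast
    then show ?case
      unfolding eq by (intro span_add span_scale span_base step.IH)
  qed
  moreover have eq: "(c *\<^sub>R a + y) \<otimes>\<^sub>t t = c *\<^sub>R (a \<otimes>\<^sub>t t) + y \<otimes>\<^sub>t t"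
    by (simp add: tensor_times_def fun_eq_iff scaleR_fun_def algebra_simps)
  ultimately show ?case
    unfolding eq by (intro span_add span_scale step.IH)
qed

lemma tensor_prod_span:
  assumes "finite P" "\<And>\<beta>. \<beta> \<in> P \<Longrightarrow> t \<beta> \<in> span (E \<beta>)"
  shows "tensor_prod P t \<in> span {tensor_prod P e | e. \<forall>\<beta>\<in>P. e \<beta> \<in> E \<beta>}"
  using assms
proof (induction P rule: finite_induct)
  case empty
  then show ?case by (auto intro!: span_base simp: tensor_prod_def)
next
  case (insert \<beta> P)
  have "t \<beta> \<otimes>\<^sub>t tensor_prod P t \<in>
      span {a \<otimes>\<^sub>t b | a b. a \<in> E \<beta> \<and> b \<in> {tensor_prod P e | e. \<forall>\<beta>\<in>P. e \<beta> \<in> E \<beta>}}"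
    using insert by (intro tensor_times_span) auto
  moreover have "{a \<otimes>\<^sub>t b | a b. a \<in> E \<beta> \<and> b \<in> {tensor_prod P e | e. \<forall>\<beta>\<in>P. e \<beta> \<in> E \<beta>}} \<subseteq>
      {tensor_prod (insert \<beta> P) e | e. \<forall>\<beta>\<in>insert \<beta> P. e \<beta> \<in> E \<beta>}"
  proof clarify
    fix a e assume a: "a \<in> E \<beta>" and e: "\<forall>\<beta>\<in>P. e \<beta> \<in> E \<beta>"
    have "tensor_prod P (e(\<beta> := a)) = tensor_prod P e"
      using insert.hyps unfolding tensor_prod_def by (intro ext prod.cong) auto
    then have "a \<otimes>\<^sub>t tensor_prod P e = tensor_prod (insert \<beta> P) (e(\<beta> := a))"
      using insert.hyps by (simp add: tensor_prod_insert)
    then show "\<exists>e'. a \<otimes>\<^sub>t tensor_prod P e = tensor_prod (insert \<beta> P) e' \<and>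
        (\<forall>\<beta>\<in>insert \<beta> P. e' \<beta> \<in> E \<beta>)"
      using a e by (intro exI[of _ "e(\<beta> := a)"]) auto
  qed
  ultimately show ?case
    unfolding tensor_prod_insert[OF insert.hyps, of t] by (rule span_mono[THEN subsetD, rotated])
qed

lemma tensor_prod_elementary_tensor:
  assumes "finite \<alpha>" "partition_on \<alpha> P" "\<And>\<beta> j. \<beta> \<in> P \<Longrightarrow> j \<in> \<beta> \<Longrightarrow> y \<beta> j = x j"
  shows "tensor_prod P (\<lambda>\<beta>. elementary_tensor \<beta> (y \<beta>)) = elementary_tensor \<alpha> x"
proof
  fix \<phi>
  have P: "\<Union>P = \<alpha>" "\<And>\<beta>. \<beta> \<in> P \<Longrightarrow> finite \<beta>" "disjoint P"
    using assms(1,2) by (auto simp: partition_on_def intro: finite_subset)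
  have "elementary_tensor \<alpha> x \<phi> = (\<Prod>\<beta>\<in>P. \<Prod>j\<in>\<beta>. dual_apply (\<phi> j) (x j))"
    unfolding elementary_tensor_def P(1)[symmetric]
    using P by (subst prod.Union_disjoint) (auto simp: disjoint_def)
  also have "\<dots> = tensor_prod P (\<lambda>\<beta>. elementary_tensor \<beta> (y \<beta>)) \<phi>"
    unfolding tensor_prod_def elementary_tensor_def using assms(3)
    by (intro prod.cong refl) auto
  finally show "tensor_prod P (\<lambda>\<beta>. elementary_tensor \<beta> (y \<beta>)) \<phi> = elementary_tensor \<alpha> x \<phi>" ..
qed

theorem tensor_prod_tensor_spaces:
  assumes fin: "finite \<alpha>" and P: "partition_on \<alpha> P"
  shows "tensor_prod_subspaces P (tensor_space V) = tensor_space V \<alpha>"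
proof
  have finP: "finite P" using assms by (rule finite_elements)
  have "tensor_prod P t \<in> tensor_space V \<alpha>" if t: "\<forall>\<beta>\<in>P. t \<beta> \<in> tensor_space V \<beta>" for t
  proof -
    have "tensor_prod P e \<in> {elementary_tensor \<alpha> x | x. \<forall>j\<in>\<alpha>. x j \<in> V j}"
      if e: "\<forall>\<beta>\<in>P. e \<beta> \<in> {elementary_tensor \<beta> x | x. \<forall>j\<in>\<beta>. x j \<in> V j}" for e
    proof -
      obtain y where y: "\<And>\<beta>. \<beta> \<in> P \<Longrightarrow> e \<beta> = elementary_tensor \<beta> (y \<beta>)"
        "\<And>\<beta> j. \<beta> \<in> P \<Longrightarrow> j \<in> \<beta> \<Longrightarrow> y \<beta> j \<in> V j"
      proof -
        have "\<forall>\<beta>\<in>P. \<exists>x. e \<beta> = elementary_tensor \<beta> x \<and> (\<forall>j\<in>\<beta>. x j \<in> V j)"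
          using e by (simp only: mem_Collect_eq)
        from bchoice[OF this] show ?thesis using that by (elim exE) simp
      qed
      define x where "x j = y (THE \<beta>. \<beta> \<in> P \<and> j \<in> \<beta>) j" for j
      have the: "(THE \<beta>. \<beta> \<in> P \<and> j \<in> \<beta>) = \<beta>" if "\<beta> \<in> P" "j \<in> \<beta>" for j \<beta>
        using that P by (intro the_equality) (auto simp: partition_on_def disjoint_def)
      have "tensor_prod P e = tensor_prod P (\<lambda>\<beta>. elementary_tensor \<beta> (y \<beta>))"
        unfolding tensor_prod_def using y(1) by (intro ext prod.cong) auto
      also have "\<dots> = elementary_tensor \<alpha> x"
        using the by (intro tensor_prod_elementary_tensor[OF fin P]) (simp add: x_def)
      finally have "tensor_prod P e = elementary_tensor \<alpha> x" .
      moreover have "x j \<in> V j" if "j \<in> \<alpha>" for j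
        using that P y(2) the unfolding x_def partition_on_def by auto
      ultimately show ?thesis by blast
    qed
    then have "span {tensor_prod P e | e.
          \<forall>\<beta>\<in>P. e \<beta> \<in> {elementary_tensor \<beta> x | x. \<forall>j\<in>\<beta>. x j \<in> V j}} \<subseteq> tensor_space V \<alpha>"
      unfolding tensor_space_def by (intro span_mono) blast
    moreover have "tensor_prod P t \<in> span {tensor_prod P e | e.
          \<forall>\<beta>\<in>P. e \<beta> \<in> {elementary_tensor \<beta> x | x. \<forall>j\<in>\<beta>. x j \<in> V j}}"
      using t unfolding tensor_space_def by (intro tensor_prod_span[OF finP]) simp
    ultimately show ?thesis by (rule subsetD)
  qed
  then show "tensor_prod_subspaces P (tensor_space V) \<subseteq> tensor_space V \<alpha>"
    unfolding tensor_prod_subspaces_def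
    by (intro span_minimal) (auto simp: tensor_space_def)
  show "tensor_space V \<alpha> \<subseteq> tensor_prod_subspaces P (tensor_space V)"
    unfolding tensor_space_def[of V \<alpha>] tensor_prod_subspaces_def
  proof (intro span_mono subsetI)
    fix e assume "e \<in> {elementary_tensor \<alpha> x | x. \<forall>j\<in>\<alpha>. x j \<in> V j}"
    then obtain x where x: "e = elementary_tensor \<alpha> x" "\<forall>j\<in>\<alpha>. x j \<in> V j" by blast
    have "e = tensor_prod P (\<lambda>\<beta>. elementary_tensor \<beta> x)"
      using tensor_prod_elementary_tensor[OF fin P, of "\<lambda>_. x" x] x(1) by simp
    moreover have "\<forall>\<beta>\<in>P. elementary_tensor \<beta> x \<in> tensor_space V \<beta>"
      using x(2) P unfolding tensor_space_def partition_on_def by (blast intro: span_base)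
    ultimately show "e \<in> {tensor_prod P t | t. \<forall>\<beta>\<in>P. t \<beta> \<in> tensor_space V \<beta>}" by blast
  qed
qed

section \<open>Minimal subspaces\<close>

definition is_minimal_subspaces ::
    "('i \<Rightarrow> 'a::real_vector set) \<Rightarrow> 'i set set \<Rightarrow> ('i, 'a) tensor \<Rightarrow>
      ('i set \<Rightarrow> ('i, 'a) tensor set) \<Rightarrow> bool"
  where "is_minimal_subspaces V P v U \<longleftrightarrow>
    (\<forall>\<beta>\<in>P. subspace (U \<beta>) \<and> U \<beta> \<subseteq> tensor_space V \<beta>) \<and>
    v \<in> tensor_prod_subspaces P U \<and>
    (\<forall>W. (\<forall>\<beta>\<in>P. subspace (W \<beta>) \<and> W \<beta> \<subseteq> tensor_space V \<beta>) \<and>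
      v \<in> tensor_prod_subspaces P W \<longrightarrow> (\<forall>\<beta>\<in>P. U \<beta> \<subseteq> W \<beta>))"

text \<open>\<open>min_subspace V \<mu> \<alpha> v\<close> is the minimal subspace in the tensor space over
  \<open>\<alpha>\<close> of a tensor \<open>v\<close> in the tensor space over \<open>\<mu> \<supseteq> \<alpha>\<close>.  It does not depend on the other
  blocks of the partition of \<open>\<mu>\<close> containing \<open>\<alpha>\<close>; the partition \<open>{\<alpha>, \<mu> - \<alpha>}\<close> is used.\<close>

definition min_subspace ::
    "('i \<Rightarrow> 'a::real_vector set) \<Rightarrow> 'i set \<Rightarrow> 'i set \<Rightarrow> ('i, 'a) tensor \<Rightarrow> ('i, 'a) tensor set"
  where "min_subspace V \<mu> \<alpha> v =
    (if \<alpha> = \<mu> then span {v}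
     else THE X. \<exists>U. is_minimal_subspaces V {\<alpha>, \<mu> - \<alpha>} v U \<and> X = U \<alpha>)"

section \<open>Dimension partition trees\<close>

text \<open>A tree is given by its set \<open>T\<close> of vertices and the function \<open>S\<close> assigning to each
  vertex the set of its sons.\<close>

definition rooted_tree :: "'v set \<Rightarrow> ('v \<Rightarrow> 'v set) \<Rightarrow> 'v \<Rightarrow> bool"
  where "rooted_tree T S \<rho> \<longleftrightarrow>
    \<rho> \<in> T \<and> (\<forall>\<alpha>\<in>T. S \<alpha> \<subseteq> T - {\<rho>}) \<and>
    (\<forall>\<beta>\<in>T - {\<rho>}. \<exists>!\<alpha>. \<alpha> \<in> T \<and> \<beta> \<in> S \<alpha>) \<and>
    (\<forall>\<beta>\<in>T. (\<rho>, \<beta>) \<in> {(\<alpha>, \<gamma>). \<alpha> \<in> T \<and> \<gamma> \<in> S \<alpha>}\<^sup>*)"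

definition dimension_partition_tree :: "'i set \<Rightarrow> 'i set set \<Rightarrow> ('i set \<Rightarrow> 'i set set) \<Rightarrow> bool"
  where "dimension_partition_tree D T S \<longleftrightarrow>
    rooted_tree T S D \<and>
    (\<forall>\<alpha>\<in>T. \<alpha> \<noteq> {} \<and> \<alpha> \<subseteq> D) \<and>
    (\<forall>\<alpha>\<in>T. 2 \<le> card \<alpha> \<longrightarrow> 2 \<le> card (S \<alpha>) \<and> partition_on \<alpha> (S \<alpha>)) \<and>
    (\<forall>\<alpha>\<in>T. card \<alpha> = 1 \<longrightarrow> S \<alpha> = {})"

definition leaves :: "'v set \<Rightarrow> ('v \<Rightarrow> 'v set) \<Rightarrow> 'v set"
  where "leaves T S = {\<alpha>\<in>T. S \<alpha> = {}}"

section \<open>Coefficient tensors\<close>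

definition multi_indices :: "'k set \<Rightarrow> ('k \<Rightarrow> nat) \<Rightarrow> ('k \<Rightarrow> nat) set"
  where "multi_indices A r = (\<Pi>\<^sub>E \<mu>\<in>A. {1..r \<mu>})"

definition matricization ::
    "'k set \<Rightarrow> ('k \<Rightarrow> nat) \<Rightarrow> 'k \<Rightarrow> (('k \<Rightarrow> nat) \<Rightarrow> real) \<Rightarrow> nat \<Rightarrow> ('k \<Rightarrow> nat) \<Rightarrow> real"
  where "matricization A r \<mu> C =
    (\<lambda>k\<in>{1..r \<mu>}. \<lambda>i\<in>multi_indices (A - {\<mu>}) r. C (i(\<mu> := k)))"

text \<open>The row rank, as for \<open>rank\<close> in \<open>HOL-Analysis\<close>, for matrices with arbitrary
  finite index sets.\<close>

definition matrix_rank :: "'m set \<Rightarrow> 'n set \<Rightarrow> ('m \<Rightarrow> 'n \<Rightarrow> real) \<Rightarrow> nat"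
  where "matrix_rank I J M = dim ((\<lambda>k i. if i \<in> J then M k i else 0) ` I)"

definition full_rank_coeffs :: "'k set \<Rightarrow> ('k \<Rightarrow> nat) \<Rightarrow> (('k \<Rightarrow> nat) \<Rightarrow> real) set"
  where "full_rank_coeffs A r = {C \<in> extensional (multi_indices A r).
    \<forall>\<mu>\<in>A. matrix_rank {1..r \<mu>} (multi_indices (A - {\<mu>}) r) (matricization A r \<mu> C) =
      min (card {1..r \<mu>}) (card (multi_indices (A - {\<mu>}) r))}"

section \<open>Tree-based representations\<close>

definition basis_family :: "nat \<Rightarrow> (nat \<Rightarrow> 'b::real_vector) \<Rightarrow> 'b set \<Rightarrow> bool"
  where "basis_family n u U \<longleftrightarrow>
    inj_on u {1..n} \<and> independent (u ` {1..n}) \<and> span (u ` {1..n}) = U"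

text \<open>The set of tensors with tree-based rank \<open>r\<close>.  All minimal subspaces of an algebraic
  tensor are finite-dimensional, so the convention \<open>dim U = 0\<close> for infinite-dimensional \<open>U\<close>
  does not matter.\<close>

definition fixed_rank_tensors ::
    "('i \<Rightarrow> 'a::real_vector set) \<Rightarrow> 'i set \<Rightarrow> 'i set set \<Rightarrow> ('i set \<Rightarrow> nat) \<Rightarrow> ('i, 'a) tensor set"
  where "fixed_rank_tensors V D T r =
    {v \<in> tensor_space V D. \<forall>\<alpha>\<in>T. dim (min_subspace V D \<alpha> v) = r \<alpha>}"

text \<open>\<open>sum_{i} C (k, i) * (tensor product of u \<beta> (i \<beta>) over the sons \<beta> of \<mu>)\<close>: the multi-index
  \<open>i\<close> runs over the sons, and \<open>i(\<mu> := k)\<close> is the full multi-index of \<open>C\<close>.\<close>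

definition son_expansion ::
    "('i set \<Rightarrow> 'i set set) \<Rightarrow> ('i set \<Rightarrow> nat) \<Rightarrow> ('i set \<Rightarrow> nat \<Rightarrow> ('i, 'a::real_vector) tensor) \<Rightarrow>
      'i set \<Rightarrow> (('i set \<Rightarrow> nat) \<Rightarrow> real) \<Rightarrow> nat \<Rightarrow> ('i, 'a) tensor"
  where "son_expansion S r u \<mu> C k =
    (\<Sum>i\<in>multi_indices (S \<mu>) r. C (i(\<mu> := k)) *\<^sub>R tensor_prod (S \<mu>) (\<lambda>\<beta>. u \<beta> (i \<beta>)))"

text \<open>The tensor written as a bold capital U with upper index \<open>\<beta>\<close> and lower indices
  \<open>k\<close>, \<open>l\<close>, where \<open>\<beta>\<close> is a son of \<open>\<mu>\<close>.\<close>

definition cofactor_tensor ::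
    "('i set \<Rightarrow> 'i set set) \<Rightarrow> ('i set \<Rightarrow> nat) \<Rightarrow> ('i set \<Rightarrow> nat \<Rightarrow> ('i, 'a::real_vector) tensor) \<Rightarrow>
      'i set \<Rightarrow> (('i set \<Rightarrow> nat) \<Rightarrow> real) \<Rightarrow> 'i set \<Rightarrow> nat \<Rightarrow> nat \<Rightarrow> ('i, 'a) tensor"
  where "cofactor_tensor S r u \<mu> C \<beta> k l =
    (\<Sum>i\<in>multi_indices (S \<mu> - {\<beta>}) r.
      C (i(\<beta> := l, \<mu> := k)) *\<^sub>R tensor_prod (S \<mu> - {\<beta>}) (\<lambda>\<delta>. u \<delta> (i \<delta>)))"

text \<open>The data of a tree-based representation of \<open>v\<close>: bases \<open>u\<close> of the minimal subspaces
  for all vertices, linked by the transfer tensors \<open>C\<close>.  Each \<open>C \<mu>\<close> is unique relative to the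
  bases \<open>u\<close> (other bases \<open>u \<mu>\<close> of the same minimal subspace have other coefficients).
  In the last clause the index \<open>1\<close> of the direction \<open>D\<close> is the one that is suppressed in the
  usual notation; the clause is void if the tree consists of the root only.\<close>

definition tree_representation ::
    "('i \<Rightarrow> 'a::real_vector set) \<Rightarrow> 'i set \<Rightarrow> 'i set set \<Rightarrow> ('i set \<Rightarrow> 'i set set) \<Rightarrow>
      ('i set \<Rightarrow> nat) \<Rightarrow> ('i, 'a) tensor \<Rightarrow> ('i set \<Rightarrow> nat \<Rightarrow> ('i, 'a) tensor) \<Rightarrow>
      ('i set \<Rightarrow> ('i set \<Rightarrow> nat) \<Rightarrow> real) \<Rightarrow> bool"
  where "tree_representation V D T S r v u C \<longleftrightarrow>
    (\<forall>k\<in>leaves T S. basis_family (r k) (u k) (min_subspace V D k v)) \<and>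
    (\<forall>\<mu>\<in>T - leaves T S.
      C \<mu> \<in> full_rank_coeffs (insert \<mu> (S \<mu>)) r \<and>
      (\<forall>k\<in>{1..r \<mu>}. u \<mu> k = son_expansion S r u \<mu> (C \<mu>) k) \<and>
      (\<forall>C'\<in>full_rank_coeffs (insert \<mu> (S \<mu>)) r.
        (\<forall>k\<in>{1..r \<mu>}. u \<mu> k = son_expansion S r u \<mu> C' k) \<longrightarrow> C' = C \<mu>) \<and>
      basis_family (r \<mu>) (u \<mu>) (min_subspace V D \<mu> v)) \<and>
    (D \<notin> leaves T S \<longrightarrow> v = son_expansion S r u D (C D) 1)"

end

theory Submission
  imports Defs
begin

text \<open>
  A tensor over \<open>\<alpha>\<close> is a function of a family \<open>\<phi>\<close> of functionals that depends only on the
  \<open>\<phi> j\<close> with \<open>j \<in> \<alpha>\<close>.  Fixing the arguments outside \<open>\<alpha>\<close> turns a tensor \<open>t\<close> into a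
  \<^emph>\<open>slice\<close> over \<open>\<alpha>\<close>, the contraction of \<open>t\<close> with functionals in all other factors.  The whole
  proof rests on the fact that the minimal subspace of \<open>v\<close> over \<open>\<alpha>\<close> is the span of the slices of
  \<open>v\<close> over \<open>\<alpha>\<close> (\<open>min_subspace_eq_slice_space\<close>).  Nothing smaller can do, because the slices over
  \<open>\<alpha>\<close> of an element of \<open>W \<otimes> W'\<close> lie in \<open>W\<close>.  The slice spaces themselves do
  (\<open>mem_tensor_prod_slice_spaces\<close>): a linear projector onto the slice space, applied to the factor
  \<open>\<alpha>\<close> alone, fixes \<open>v\<close> and moves the factor \<open>\<alpha>\<close> of every term of \<open>v\<close> into the slice space.
  Since slices of slices are slices, the minimal subspace of \<open>v\<close> over \<open>\<beta> \<subseteq> \<mu>\<close> is spanned by those of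
  any basis of the minimal subspace over \<open>\<mu>\<close> (\<open>slice_space_nested\<close>), and the minimal subspace over
  \<open>\<mu>\<close> is contained in the tensor product of those over the sons of \<open>\<mu>\<close> (\<open>slice_space_sons\<close>).

  A tree-based representation contains bases of all minimal subspaces, so their dimensions are
  the \<open>r \<alpha>\<close>.  Conversely, choose any bases of the minimal subspaces, with \<open>v\<close> itself at the
  root, and expand each basis vector over \<open>\<mu>\<close> in the products of basis vectors over the sons;
  the coefficients are unique because these products are linearly independent
  (\<open>tensor_prod_coeff_zero\<close>).  The coefficient tensor has full rank
  (\<open>full_rank_transfer_tensor\<close>): a relation between its rows in direction \<open>\<mu>\<close> is one between the
  basis vectors over \<open>\<mu>\<close>; a relation between its rows in direction of a son \<open>\<beta>\<close> is a functional
  that vanishes on all slices over \<open>\<beta>\<close> of the basis vectors over \<open>\<mu>\<close>, hence on the minimal subspace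
  over \<open>\<beta>\<close>, which they span, so that the relation is trivial.

  For the spans of the cofactor tensors, group the terms of an expansion as \<open>\<Sum>l. u \<beta> l \<otimes> W l\<close>.
  Because the \<open>u \<beta> l\<close> are independent, the slices over the complement of \<open>\<beta>\<close> span the same
  space as the \<open>W l\<close> (\<open>slice_space_cofactors\<close>).
\<close>

section \<open>Slices of tensors\<close>

definition local_on :: "'i set \<Rightarrow> ('i, 'a::real_vector) tensor \<Rightarrow> bool"
  where "local_on \<alpha> t \<longleftrightarrow> (\<forall>\<phi> \<psi>. (\<forall>j\<in>\<alpha>. \<phi> j = \<psi> j) \<longrightarrow> t \<phi> = t \<psi>)"

definition slice :: "'i set \<Rightarrow> ('i \<Rightarrow> 'a dual) \<Rightarrow> ('i, 'a::real_vector) tensor \<Rightarrow> ('i, 'a) tensor"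
  where "slice \<alpha> \<psi> t = (\<lambda>\<phi>. t (override_on \<psi> \<phi> \<alpha>))"

definition slice_space :: "'i set \<Rightarrow> ('i, 'a::real_vector) tensor \<Rightarrow> ('i, 'a) tensor set"
  where "slice_space \<alpha> t = span (range (\<lambda>\<psi>. slice \<alpha> \<psi> t))"

text \<open>For linear \<open>f\<close> and \<open>t = a \<otimes> b\<close> with \<open>a\<close> over \<open>\<alpha>\<close> and \<open>b\<close> over other indices, this is \<open>f a \<otimes> b\<close>; the
  formula below is the operator \<open>f \<otimes> id\<close> written without a decomposition of \<open>t\<close>, so that
  well-definedness is no issue.\<close>

definition apply_on ::
    "'i set \<Rightarrow> (('i, 'a::real_vector) tensor \<Rightarrow> ('i, 'a) tensor) \<Rightarrow> ('i, 'a) tensor \<Rightarrow> ('i, 'a) tensor"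
  where "apply_on \<alpha> f t = (\<lambda>\<phi>. f (slice \<alpha> \<phi> t) \<phi>)"

lemma scaleR_fun_apply: "(c *\<^sub>R f) x = c *\<^sub>R f x"
  by (simp add: scaleR_fun_def)

lemma linear_slice: "linear (slice \<alpha> \<psi>)"
  by (rule linearI) (simp_all add: slice_def fun_eq_iff scaleR_fun_def)

lemma linear_apply_on:
  assumes "linear f"
  shows "linear (apply_on \<alpha> f)"
  by (intro linearI ext)
    (simp_all only: apply_on_def plus_fun_apply scaleR_fun_apply linear_add[OF linear_slice]
      linear_scale[OF linear_slice] linear_add[OF assms] linear_scale[OF assms])

lemma local_on_elementary_tensor: "local_on \<alpha> (elementary_tensor \<alpha> x)"
  by (auto simp: local_on_def elementary_tensor_def intro!: prod.cong)

lemma local_on_span: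
  assumes "t \<in> span A" "\<And>a. a \<in> A \<Longrightarrow> local_on \<alpha> a"
  shows "local_on \<alpha> t"
  using assms(1)
proof (induction rule: span_induct_alt)
  case base
  show ?case by (simp add: local_on_def)
next
  case (step c a t)
  then show ?case using assms(2)[of a]
    unfolding local_on_def plus_fun_apply scaleR_fun_def by metis
qed

lemma local_on_tensor_space: "t \<in> tensor_space V \<alpha> \<Longrightarrow> local_on \<alpha> t"
  unfolding tensor_space_def by (erule local_on_span) (auto simp: local_on_elementary_tensor)

lemma local_on_slice: "local_on \<alpha> (slice \<alpha> \<psi> t)"
  unfolding local_on_def slice_def
  by (intro allI impI arg_cong[where f = t]) (auto simp: override_on_def)

lemma local_on_slice_space: "s \<in> slice_space \<alpha> t \<Longrightarrow> local_on \<alpha> s"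
  unfolding slice_space_def by (erule local_on_span) (auto simp: local_on_slice)

lemma local_on_tensor_prod:
  assumes "\<And>\<beta>. \<beta> \<in> P \<Longrightarrow> local_on \<beta> (t \<beta>)"
  shows "local_on (\<Union>P) (tensor_prod P t)"
  using assms unfolding local_on_def tensor_prod_def
  by (intro allI impI prod.cong refl) (meson UnionI)

lemma tensor_times_commute: "s \<otimes>\<^sub>t t = t \<otimes>\<^sub>t s"
  by (simp add: tensor_times_def fun_eq_iff)

lemma slice_times:
  assumes "local_on \<alpha> a" "local_on \<beta> b" "\<alpha> \<inter> \<beta> = {}"
  shows "slice \<alpha> \<psi> (a \<otimes>\<^sub>t b) = b \<psi> *\<^sub>R a"
proof
  fix \<phi>
  have "a (override_on \<psi> \<phi> \<alpha>) = a \<phi>"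
    using assms(1) unfolding local_on_def by (auto simp: override_on_def)
  moreover have "override_on \<psi> \<phi> \<alpha> j = \<psi> j" if "j \<in> \<beta>" for j
    using assms(3) that by (auto simp: override_on_def)
  then have "b (override_on \<psi> \<phi> \<alpha>) = b \<psi>"
    using assms(2) unfolding local_on_def by blast
  ultimately show "slice \<alpha> \<psi> (a \<otimes>\<^sub>t b) \<phi> = (b \<psi> *\<^sub>R a) \<phi>"
    by (simp add: slice_def tensor_times_def scaleR_fun_def)
qed

lemma apply_on_times:
  assumes "linear f" "local_on \<alpha> a" "local_on \<beta> b" "\<alpha> \<inter> \<beta> = {}"
  shows "apply_on \<alpha> f (a \<otimes>\<^sub>t b) = f a \<otimes>\<^sub>t b"
  by (rule ext) (simp only: apply_on_def slice_times[OF assms(2-4)] linear_scale[OF assms(1)],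
      simp add: tensor_times_def scaleR_fun_apply)

text \<open>The value of \<open>t\<close> at \<open>\<phi>\<close> is the value at \<open>\<phi>\<close> of its slice with outer arguments \<open>\<phi>\<close>.\<close>

lemma apply_on_fixed:
  assumes "\<And>\<psi>. f (slice \<alpha> \<psi> t) = slice \<alpha> \<psi> t"
  shows "apply_on \<alpha> f t = t"
  by (simp add: apply_on_def assms fun_eq_iff) (simp add: slice_def override_on_def)

lemma slice_in_slice_space: "slice \<alpha> \<psi> t \<in> slice_space \<alpha> t"
  unfolding slice_space_def by (auto intro: span_base)

lemma subspace_slice_space [simp]: "subspace (slice_space \<alpha> t)"
  by (simp add: slice_space_def)

lemma slice_space_subset:
  assumes "subspace W" "\<And>\<psi>. slice \<alpha> \<psi> t \<in> W"
  shows "slice_space \<alpha> t \<subseteq> W"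
  unfolding slice_space_def using assms by (intro span_minimal) auto

lemma slice_slice:
  assumes "\<beta> \<subseteq> \<alpha>"
  shows "slice \<beta> \<psi> (slice \<alpha> \<omega> t) = slice \<beta> (override_on \<omega> \<psi> \<alpha>) t"
proof
  fix \<phi>
  have "override_on \<omega> (override_on \<psi> \<phi> \<beta>) \<alpha> = override_on (override_on \<omega> \<psi> \<alpha>) \<phi> \<beta>"
    using assms by (auto simp: override_on_def fun_eq_iff)
  then show "slice \<beta> \<psi> (slice \<alpha> \<omega> t) \<phi> = slice \<beta> (override_on \<omega> \<psi> \<alpha>) t \<phi>"
    by (simp add: slice_def)
qed

text \<open>Every slice over \<open>\<beta>\<close> is also a slice over \<open>\<beta>\<close> of a slice over \<open>\<alpha>\<close>: take the same outer
  arguments twice.\<close>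

lemma slice_space_nested:
  assumes "\<beta> \<subseteq> \<alpha>" "span G = slice_space \<alpha> t"
  shows "slice_space \<beta> t = span (\<Union>s\<in>G. slice_space \<beta> s)"
proof
  show "slice_space \<beta> t \<subseteq> span (\<Union>s\<in>G. slice_space \<beta> s)"
  proof (rule slice_space_subset)
    fix \<psi>
    have "slice \<beta> \<psi> t = slice \<beta> \<psi> (slice \<alpha> \<psi> t)"
      using slice_slice[OF assms(1), of \<psi> \<psi> t] by (simp add: override_on_def)
    moreover have "slice \<alpha> \<psi> t \<in> span G"
      unfolding assms(2) by (rule slice_in_slice_space)
    ultimately have "slice \<beta> \<psi> t \<in> span (slice \<beta> \<psi> ` G)"
      unfolding linear_span_image[OF linear_slice] by blast
    moreover have "span (slice \<beta> \<psi> ` G) \<subseteq> span (\<Union>s\<in>G. slice_space \<beta> s)"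
      by (intro span_mono) (auto intro: slice_in_slice_space)
    ultimately show "slice \<beta> \<psi> t \<in> span (\<Union>s\<in>G. slice_space \<beta> s)" by blast
  qed simp
  have "slice_space \<beta> s \<subseteq> slice_space \<beta> t" if s: "s \<in> G" for s
  proof (rule slice_space_subset)
    fix \<psi>
    have "s \<in> slice_space \<alpha> t" unfolding assms(2)[symmetric] using s by (rule span_base)
    then have "slice \<beta> \<psi> s \<in> span (slice \<beta> \<psi> ` range (\<lambda>\<omega>. slice \<alpha> \<omega> t))"
      unfolding slice_space_def linear_span_image[OF linear_slice] by blast
    also have "\<dots> \<subseteq> slice_space \<beta> t"
      unfolding slice_space_def by (intro span_mono) (auto simp: slice_slice[OF assms(1)])
    finally show "slice \<beta> \<psi> s \<in> slice_space \<beta> t" .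
  qed simp
  then show "span (\<Union>s\<in>G. slice_space \<beta> s) \<subseteq> slice_space \<beta> t"
    by (intro span_minimal) auto
qed

lemma slice_space_total:
  assumes "local_on \<mu> t"
  shows "slice_space \<mu> t = span {t}"
proof -
  have "slice \<mu> \<psi> t = t" for \<psi>
    using assms unfolding local_on_def slice_def
    by (intro ext) (simp add: override_on_def)
  then show ?thesis by (simp add: slice_space_def)
qed

lemma slice_elementary_tensor:
  assumes "finite \<mu>" "\<alpha> \<subseteq> \<mu>"
  shows "slice \<alpha> \<psi> (elementary_tensor \<mu> x) =
    elementary_tensor (\<mu> - \<alpha>) x \<psi> *\<^sub>R elementary_tensor \<alpha> x"
proof -
  have "elementary_tensor \<mu> x = elementary_tensor \<alpha> x \<otimes>\<^sub>t elementary_tensor (\<mu> - \<alpha>) x"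
    unfolding elementary_tensor_def tensor_times_def
    by (subst prod.subset_diff[OF assms(2,1)]) (simp add: mult.commute)
  then show ?thesis
    using slice_times[OF local_on_elementary_tensor local_on_elementary_tensor, of \<alpha> "\<mu> - \<alpha>"] by auto
qed

text \<open>Each slice of an elementary tensor over \<open>\<mu>\<close> is a multiple of one elementary tensor over
  \<open>\<alpha>\<close>, so an algebraic tensor, being a finite sum, has only finitely many independent slices.\<close>

lemma slice_space_finite:
  assumes "finite \<mu>" "\<alpha> \<subseteq> \<mu>" "t \<in> tensor_space V \<mu>"
  shows "\<exists>F. finite F \<and> F \<subseteq> tensor_space V \<alpha> \<and> slice_space \<alpha> t \<subseteq> span F"
proof -
  have "\<exists>F. finite F \<and> F \<subseteq> tensor_space V \<alpha> \<and> (\<forall>\<psi>. slice \<alpha> \<psi> t \<in> span F)"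
    using assms(3) unfolding tensor_space_def[of V \<mu>]
  proof (induction rule: span_induct_alt)
    case base
    have "slice \<alpha> \<psi> 0 \<in> span {}" for \<psi> :: "'a \<Rightarrow> 'b dual"
      by (simp add: linear_0[OF linear_slice])
    then show ?case by blast
  next
    case (step c e t)
    then obtain F x where F: "finite F" "F \<subseteq> tensor_space V \<alpha>" "\<And>\<psi>. slice \<alpha> \<psi> t \<in> span F"
      and x: "e = elementary_tensor \<mu> x" "\<forall>j\<in>\<mu>. x j \<in> V j" by blast
    let ?e = "elementary_tensor \<alpha> x"
    have "slice \<alpha> \<psi> (c *\<^sub>R e + t) \<in> span (insert ?e F)" for \<psi>
      unfolding linear_add[OF linear_slice] linear_scale[OF linear_slice] x
        slice_elementary_tensor[OF assms(1,2)]
      using F(3)[of \<psi>] span_mono[of F "insert ?e F"]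
      by (intro span_add span_scale) (auto intro: span_base)
    moreover have "?e \<in> tensor_space V \<alpha>"
      using x(2) assms(2) unfolding tensor_space_def by (auto intro!: span_base)
    ultimately show ?case using F(1,2)
      by (intro exI[of _ "insert ?e F"] conjI allI finite.insertI insert_subsetI)
  qed
  then show ?thesis using slice_space_subset by (metis subspace_span)
qed

lemma slice_space_subset_tensor_space:
  assumes "finite \<mu>" "\<alpha> \<subseteq> \<mu>" "t \<in> tensor_space V \<mu>"
  shows "slice_space \<alpha> t \<subseteq> tensor_space V \<alpha>"
proof -
  obtain F where "F \<subseteq> tensor_space V \<alpha>" "slice_space \<alpha> t \<subseteq> span F"
    using slice_space_finite[OF assms] by blast
  moreover have "span F \<subseteq> tensor_space V \<alpha>"
    using calculation(1) by (intro span_minimal) (simp_all add: tensor_space_def)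
  ultimately show ?thesis by blast
qed

section \<open>Minimal subspaces are slice spaces\<close>

lemma ex_projector:
  fixes W :: "'b::real_vector set"
  assumes "subspace W"
  obtains \<pi> where "linear \<pi>" "\<And>x. \<pi> x \<in> W" "\<And>x. x \<in> W \<Longrightarrow> \<pi> x = x"
  using linear_exists_left_inverse_on[OF linear_id assms] by auto

text \<open>The blocks are treated one after the other: with a projector \<open>\<pi>\<close> onto the slice space over
  \<open>\<alpha>\<close>, the operator \<open>apply_on \<alpha> \<pi>\<close> fixes \<open>v\<close>, and in a sum of products that represents \<open>v\<close> it replaces
  each factor over \<open>\<alpha>\<close> by an element of the slice space and changes no other factor.\<close>

lemma mem_tensor_prod_slice_spaces:
  assumes P: "finite P" "disjoint P"
    and loc: "\<And>\<beta> t. \<beta> \<in> P \<Longrightarrow> t \<in> W \<beta> \<Longrightarrow> local_on \<beta> t"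
    and v: "v \<in> tensor_prod_subspaces P W"
  shows "v \<in> tensor_prod_subspaces P (\<lambda>\<beta>. slice_space \<beta> v)"
proof -
  have "v \<in> tensor_prod_subspaces P (\<lambda>\<beta>. if \<beta> \<in> Q then slice_space \<beta> v else W \<beta>)"
    if "Q \<subseteq> P" for Q
    using finite_subset[OF that P(1)] that
  proof (induction Q rule: finite_induct)
    case empty
    then show ?case using v by simp
  next
    case (insert \<alpha> Q)
    \<comment> \<open>\<open>Q\<close> is the set of blocks already treated, \<open>\<alpha>\<close> the next one.\<close>
    define U where "U = (\<lambda>\<beta>. if \<beta> \<in> Q then slice_space \<beta> v else W \<beta>)"
    define U' where "U' = (\<lambda>\<beta>. if \<beta> \<in> insert \<alpha> Q then slice_space \<beta> v else W \<beta>)"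
    have \<alpha>: "\<alpha> \<in> P" using insert.prems by simp
    obtain \<pi> where \<pi>: "linear \<pi>" "\<And>x. \<pi> x \<in> slice_space \<alpha> v" "\<And>x. x \<in> slice_space \<alpha> v \<Longrightarrow> \<pi> x = x"
      by (rule ex_projector[OF subspace_slice_space]) blast
    have fixed: "apply_on \<alpha> \<pi> v = v"
      by (rule apply_on_fixed) (simp add: \<pi>(3) slice_in_slice_space)
    have "v \<in> span {tensor_prod P t | t. \<forall>\<beta>\<in>P. t \<beta> \<in> U \<beta>}"
      using insert unfolding U_def tensor_prod_subspaces_def by simp
    then have "apply_on \<alpha> \<pi> v \<in> span (apply_on \<alpha> \<pi> ` {tensor_prod P t | t. \<forall>\<beta>\<in>P. t \<beta> \<in> U \<beta>})"
      unfolding linear_span_image[OF linear_apply_on[OF \<pi>(1)]] by (rule imageI)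
    moreover have "apply_on \<alpha> \<pi> (tensor_prod P t) = tensor_prod P (t(\<alpha> := \<pi> (t \<alpha>)))"
      if t: "\<forall>\<beta>\<in>P. t \<beta> \<in> U \<beta>" for t
    proof -
      have P_eq: "P = insert \<alpha> (P - {\<alpha>})" using \<alpha> by blast
      have split: "tensor_prod P s = s \<alpha> \<otimes>\<^sub>t tensor_prod (P - {\<alpha>}) s" for s :: "'a set \<Rightarrow> ('a, 'b) tensor"
        by (subst P_eq) (rule tensor_prod_insert, use P in auto)
      have local_t: "local_on \<beta> (t \<beta>)" if \<beta>: "\<beta> \<in> P" for \<beta>
        using bspec[OF t \<beta>] loc[OF \<beta>] unfolding U_def
        by (auto split: if_splits intro: local_on_slice_space)
      have "local_on (\<Union>(P - {\<alpha>})) (tensor_prod (P - {\<alpha>}) t)"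
        by (rule local_on_tensor_prod) (simp add: local_t)
      moreover have "\<alpha> \<inter> \<Union>(P - {\<alpha>}) = {}"
        using P(2) \<alpha> unfolding disjoint_def by blast
      ultimately have "apply_on \<alpha> \<pi> (tensor_prod P t) = \<pi> (t \<alpha>) \<otimes>\<^sub>t tensor_prod (P - {\<alpha>}) t"
        unfolding split[of t] by (intro apply_on_times[OF \<pi>(1) local_t[OF \<alpha>]])
      also have "tensor_prod (P - {\<alpha>}) t = tensor_prod (P - {\<alpha>}) (t(\<alpha> := \<pi> (t \<alpha>)))"
        unfolding tensor_prod_def by (intro ext prod.cong) auto
      finally show ?thesis unfolding split[of "t(\<alpha> := \<pi> (t \<alpha>))"] by simp
    qed
    then have "apply_on \<alpha> \<pi> ` {tensor_prod P t | t. \<forall>\<beta>\<in>P. t \<beta> \<in> U \<beta>} \<subseteq>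
        {tensor_prod P t | t. \<forall>\<beta>\<in>P. t \<beta> \<in> U' \<beta>}"
    proof (intro image_subsetI, clarify)
      fix t assume t: "\<forall>\<beta>\<in>P. t \<beta> \<in> U \<beta>"
        and eq: "\<And>t. \<forall>\<beta>\<in>P. t \<beta> \<in> U \<beta> \<Longrightarrow>
          apply_on \<alpha> \<pi> (tensor_prod P t) = tensor_prod P (t(\<alpha> := \<pi> (t \<alpha>)))"
      have "\<forall>\<beta>\<in>P. (t(\<alpha> := \<pi> (t \<alpha>))) \<beta> \<in> U' \<beta>"
        using t \<pi>(2) unfolding U_def U'_def by auto
      then show "\<exists>t'. apply_on \<alpha> \<pi> (tensor_prod P t) = tensor_prod P t' \<and> (\<forall>\<beta>\<in>P. t' \<beta> \<in> U' \<beta>)"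
        using eq[OF t] by blast
    qed
    ultimately show ?case
      unfolding tensor_prod_subspaces_def U'_def fixed by (meson span_mono subsetD)
  qed
  from this[of P] have "v \<in> tensor_prod_subspaces P (\<lambda>\<beta>. if \<beta> \<in> P then slice_space \<beta> v else W \<beta>)"
    by simp
  also have "tensor_prod_subspaces P (\<lambda>\<beta>. if \<beta> \<in> P then slice_space \<beta> v else W \<beta>) =
      tensor_prod_subspaces P (\<lambda>\<beta>. slice_space \<beta> v)"
    unfolding tensor_prod_subspaces_def by (intro arg_cong[where f = span]) auto
  finally show ?thesis .
qed

lemma is_minimal_subspaces_mono:
  assumes "is_minimal_subspaces V P v U" "is_minimal_subspaces V P v U'" "\<beta> \<in> P"
  shows "U \<beta> \<subseteq> U' \<beta>"
proof -
  have "(\<forall>\<beta>\<in>P. subspace (U' \<beta>) \<and> U' \<beta> \<subseteq> tensor_space V \<beta>) \<and> v \<in> tensor_prod_subspaces P U'"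
    using assms(2) unfolding is_minimal_subspaces_def by (elim conjE) (intro conjI)
  then have "\<forall>\<beta>\<in>P. U \<beta> \<subseteq> U' \<beta>"
    by (rule assms(1)[unfolded is_minimal_subspaces_def, THEN conjunct2, THEN conjunct2,
          THEN spec, THEN mp])
  then show ?thesis using assms(3) by (rule bspec)
qed

text \<open>Minimality holds because a slice over \<open>\<beta>\<close> of a product is a multiple of its factor over
  \<open>\<beta>\<close>; hence the slices of \<open>v\<close> lie in each \<open>W \<beta>\<close> whose products span a space containing \<open>v\<close>.\<close>

lemma min_subspace_eq_slice_space:
  assumes "finite \<mu>" "\<alpha> \<subseteq> \<mu>" "\<alpha> \<noteq> {}" "v \<in> tensor_space V \<mu>"
  shows "min_subspace V \<mu> \<alpha> v = slice_space \<alpha> v"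
proof (cases "\<alpha> = \<mu>")
  case True
  then show ?thesis
    using slice_space_total[OF local_on_tensor_space[OF assms(4)]] by (simp add: min_subspace_def)
next
  case False
  let ?P = "{\<alpha>, \<mu> - \<alpha>}"
  have part: "partition_on \<mu> ?P"
    using assms(2,3) False by (auto simp: partition_on_def disjoint_def)
  have dist: "\<alpha> \<noteq> \<mu> - \<alpha>" using assms(3) by blast
  have sub: "\<beta> \<subseteq> \<mu>" if "\<beta> \<in> ?P" for \<beta> using that assms(2) by auto
  have least: "slice_space \<beta> v \<subseteq> W \<beta>"
    if W: "\<forall>\<beta>\<in>?P. subspace (W \<beta>) \<and> W \<beta> \<subseteq> tensor_space V \<beta>" "v \<in> tensor_prod_subspaces ?P W"
      and \<beta>: "\<beta> \<in> ?P" for W \<beta>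
  proof (rule slice_space_subset)
    show "subspace (W \<beta>)" using W \<beta> by blast
    fix \<psi>
    let ?G = "{tensor_prod ?P t | t. \<forall>\<beta>\<in>?P. t \<beta> \<in> W \<beta>}"
    have "slice \<beta> \<psi> v \<in> span (slice \<beta> \<psi> ` ?G)"
      using W(2) unfolding tensor_prod_subspaces_def linear_span_image[OF linear_slice] by blast
    moreover have "slice \<beta> \<psi> ` ?G \<subseteq> W \<beta>"
    proof (intro image_subsetI, clarify)
      fix t assume t: "\<forall>\<beta>\<in>?P. t \<beta> \<in> W \<beta>"
      have loc: "local_on \<beta> (t \<beta>)" if "\<beta> \<in> ?P" for \<beta>
        using t W(1) that local_on_tensor_space by blast
      have eq: "tensor_prod ?P t = t \<alpha> \<otimes>\<^sub>t t (\<mu> - \<alpha>)"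
        using dist by (simp add: tensor_prod_def tensor_times_def fun_eq_iff)
      have "\<exists>c. slice \<beta> \<psi> (tensor_prod ?P t) = c *\<^sub>R t \<beta>"
        using \<beta>
      proof (elim insertE emptyE)
        assume \<beta>: "\<beta> = \<alpha>"
        show ?thesis unfolding eq \<beta>
          using slice_times[OF loc loc, of \<alpha> "\<mu> - \<alpha>" \<psi>] by auto
      next
        assume \<beta>: "\<beta> = \<mu> - \<alpha>"
        show ?thesis unfolding eq \<beta> tensor_times_commute[of "t \<alpha>"]
          using slice_times[OF loc loc, of "\<mu> - \<alpha>" \<alpha> \<psi>] by auto
      qed
      then obtain c where "slice \<beta> \<psi> (tensor_prod ?P t) = c *\<^sub>R t \<beta>" ..
      moreover have "c *\<^sub>R t \<beta> \<in> W \<beta>"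
        using W(1) t \<beta> by (intro subspace_scale) auto
      ultimately show "slice \<beta> \<psi> (tensor_prod ?P t) \<in> W \<beta>" by (simp only:)
    qed
    ultimately show "slice \<beta> \<psi> v \<in> W \<beta>"
      using \<open>subspace (W \<beta>)\<close> by (meson span_minimal subsetD)
  qed
  have "v \<in> tensor_prod_subspaces ?P (tensor_space V)"
    unfolding tensor_prod_tensor_spaces[OF assms(1) part] by (rule assms(4))
  then have "v \<in> tensor_prod_subspaces ?P (\<lambda>\<beta>. slice_space \<beta> v)"
    using part by (intro mem_tensor_prod_slice_spaces[where W = "tensor_space V"])
      (auto simp: partition_on_def local_on_tensor_space)
  moreover have "slice_space \<beta> v \<subseteq> tensor_space V \<beta>" if "\<beta> \<in> ?P" for \<beta>
    by (rule slice_space_subset_tensor_space[OF assms(1) sub[OF that] assms(4)])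
  ultimately have min: "is_minimal_subspaces V ?P v (\<lambda>\<beta>. slice_space \<beta> v)"
    unfolding is_minimal_subspaces_def using least by simp
  have "(THE X. \<exists>U. is_minimal_subspaces V ?P v U \<and> X = U \<alpha>) = slice_space \<alpha> v"
  proof (rule the_equality)
    show "\<exists>U. is_minimal_subspaces V ?P v U \<and> slice_space \<alpha> v = U \<alpha>"
      by (intro exI conjI, rule min, rule refl)
    fix X assume "\<exists>U. is_minimal_subspaces V ?P v U \<and> X = U \<alpha>"
    then obtain U where U: "is_minimal_subspaces V ?P v U" "X = U \<alpha>" by (elim exE conjE)
    show "X = slice_space \<alpha> v"
      unfolding U(2)
      using is_minimal_subspaces_mono[OF U(1) min, of \<alpha>]
        is_minimal_subspaces_mono[OF min U(1), of \<alpha>] by (intro equalityI) simp_all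
  qed
  then show ?thesis using False unfolding min_subspace_def by (simp only: if_False)
qed
section \<open>Linear independence\<close>

lemma independent_family_iff:
  fixes u :: "'k \<Rightarrow> 'b::real_vector"
  assumes "finite A"
  shows "inj_on u A \<and> independent (u ` A) \<longleftrightarrow>
    (\<forall>c. (\<Sum>l\<in>A. c l *\<^sub>R u l) = 0 \<longrightarrow> (\<forall>l\<in>A. c l = 0))"
proof (intro iffI allI impI ballI)
  fix c l
  assume u: "inj_on u A \<and> independent (u ` A)" and 0: "(\<Sum>l\<in>A. c l *\<^sub>R u l) = 0" and l: "l \<in> A"
  have "(\<Sum>x\<in>u ` A. c (the_inv_into A u x) *\<^sub>R x) = (\<Sum>l\<in>A. c l *\<^sub>R u l)"
    using u by (subst sum.reindex) (auto simp: the_inv_into_f_f intro!: sum.cong)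
  then have "c (the_inv_into A u (u l)) = 0"
    using u assms l 0 by (intro independentD[of "u ` A" "u ` A" "\<lambda>x. c (the_inv_into A u x)"]) auto
  then show "c l = 0" using u l by (simp add: the_inv_into_f_f)
next
  assume c: "\<forall>c. (\<Sum>l\<in>A. c l *\<^sub>R u l) = 0 \<longrightarrow> (\<forall>l\<in>A. c l = 0)"
  have inj: "inj_on u A"
  proof (rule inj_onI, rule ccontr)
    fix a b assume ab: "a \<in> A" "b \<in> A" "u a = u b" "a \<noteq> b"
    let ?c = "\<lambda>l. (if l = a then 1 else 0) - (if l = b then 1 else 0) :: real"
    have "(\<Sum>l\<in>A. ?c l *\<^sub>R u l) = (\<Sum>l\<in>A. if l = a then u l else 0) - (\<Sum>l\<in>A. if l = b then u l else 0)"
      unfolding sum_subtractf[symmetric] by (intro sum.cong) (auto simp: scaleR_left_diff_distrib)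
    also have "\<dots> = 0" using ab assms by simp
    finally have "?c a = 0"
      using c[THEN spec[of _ ?c]] ab(1) by blast
    then show False using ab(4) by simp
  qed
  have "independent (u ` A)"
  proof (rule independent_if_scalars_zero)
    show "finite (u ` A)" using assms by simp
    fix f x assume f: "(\<Sum>x\<in>u ` A. f x *\<^sub>R x) = 0" and x: "x \<in> u ` A"
    have "(\<Sum>l\<in>A. f (u l) *\<^sub>R u l) = 0"
      using f unfolding sum.reindex[OF inj] by simp
    then show "f x = 0" using c[rule_format, of "\<lambda>l. f (u l)"] x by blast
  qed
  with inj show "inj_on u A \<and> independent (u ` A)" by simp
qed

lemma basis_family_coeff_zero:
  assumes "basis_family n u U" "(\<Sum>l\<in>{1..n}. c l *\<^sub>R u l) = 0" "l \<in> {1..n}"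
  shows "c l = 0"
  using assms independent_family_iff[of "{1..n}" u] unfolding basis_family_def by blast

lemma basis_family_dim: "basis_family n u U \<Longrightarrow> dim U = n"
  unfolding basis_family_def
  by (metis card_atLeastAtMost card_image diff_Suc_1 dim_eq_card_independent dim_span)

lemma basis_family_mem: "basis_family n u U \<Longrightarrow> l \<in> {1..n} \<Longrightarrow> u l \<in> U"
  unfolding basis_family_def by (auto intro: span_base)

lemma ex_basis_family:
  fixes U :: "'b::real_vector set"
  assumes "subspace U" "finite F" "U \<subseteq> span F"
  shows "\<exists>u. basis_family (dim U) u U"
proof -
  obtain B where B: "B \<subseteq> U" "independent B" "U \<subseteq> span B" "card B = dim U"
    by (rule basis_exists)
  have "finite B" using independent_span_bound[OF assms(2) B(2)] B(1) assms(3) by blast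
  then obtain u where "bij_betw u {1..dim U} B"
    using ex_bij_betw_nat_finite_1[of B] B(4) by auto
  moreover have "span B = U" using B assms(1) by (intro subset_antisym span_minimal)
  ultimately show ?thesis using B(2) unfolding basis_family_def bij_betw_def by blast
qed

text \<open>The coefficients are indexed by \<open>A\<close> rather than by the image, so \<open>f\<close> may take a value several
  times.\<close>

lemma mem_span_image:
  assumes "finite A" "x \<in> span (f ` A)"
  shows "\<exists>c. x = (\<Sum>i\<in>A. c i *\<^sub>R f i)"
  using assms(2)
proof (induction rule: span_induct_alt)
  case base
  have "0 = (\<Sum>i\<in>A. 0 *\<^sub>R f i)" by (simp only: scaleR_zero_left sum.neutral_const)
  then show ?case by (rule exI[of _ "\<lambda>_. 0"])
next
  case (step k y x)
  then obtain j c where j: "j \<in> A" "y = f j" and c: "x = (\<Sum>i\<in>A. c i *\<^sub>R f i)" by blast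
  have "k *\<^sub>R y = (\<Sum>i\<in>A. (if i = j then k else 0) *\<^sub>R f i)"
    using j assms(1) by (subst sum.remove[of A j]) auto
  then have "k *\<^sub>R y + x = (\<Sum>i\<in>A. ((if i = j then k else 0) + c i) *\<^sub>R f i)"
    unfolding c scaleR_add_left sum.distrib by (simp only:)
  then show ?case by (rule exI[of _ "\<lambda>i. (if i = j then k else 0) + c i"])
qed

lemma tensor_times_scaleR_right: "s \<otimes>\<^sub>t (c *\<^sub>R t) = c *\<^sub>R (s \<otimes>\<^sub>t t)"
  by (simp add: tensor_times_def fun_eq_iff scaleR_fun_apply)

lemma tensor_times_diff_right: "s \<otimes>\<^sub>t (t - t') = s \<otimes>\<^sub>t t - s \<otimes>\<^sub>t t'"
  by (simp add: tensor_times_def fun_eq_iff algebra_simps)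

lemma tensor_times_sum_right: "s \<otimes>\<^sub>t (\<Sum>i\<in>A. t i) = (\<Sum>i\<in>A. s \<otimes>\<^sub>t t i)"
  by (simp add: tensor_times_def fun_eq_iff sum_fun_apply sum_distrib_left)

lemma local_on_sum_scaleR:
  assumes "\<And>i. i \<in> A \<Longrightarrow> local_on \<alpha> (t i)"
  shows "local_on \<alpha> (\<Sum>i\<in>A. c i *\<^sub>R t i)"
proof (rule local_on_span)
  show "(\<Sum>i\<in>A. c i *\<^sub>R t i) \<in> span (t ` A)"
    by (intro span_sum span_scale span_base imageI)
qed (use assms in blast)

lemma slice_times_right:
  assumes "local_on \<alpha> a" "local_on \<beta> b" "\<alpha> \<inter> \<beta> = {}"
  shows "slice \<beta> \<psi> (a \<otimes>\<^sub>t b) = a \<psi> *\<^sub>R b"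
  unfolding tensor_times_commute[of a] using slice_times[OF assms(2,1)] assms(3) by (simp add: Int_commute)

section \<open>Sums of products with linearly independent left factors\<close>

context
  fixes \<alpha> \<beta> :: "'i set" and a :: "nat \<Rightarrow> ('i, 'a::real_vector) tensor" and U n
  assumes disj: "\<alpha> \<inter> \<beta> = {}" and basis: "basis_family n a U"
    and local_a: "\<And>l. l \<in> {1..n} \<Longrightarrow> local_on \<alpha> (a l)"
begin

text \<open>Evaluating the right factors at a point turns the relation into a linear relation between the
  left factors.\<close>

lemma tensor_times_sum_eq_0:
  assumes local_b: "\<And>l. l \<in> {1..n} \<Longrightarrow> local_on \<beta> (b l)"
    and 0: "(\<Sum>l\<in>{1..n}. a l \<otimes>\<^sub>t b l) = 0" and l: "l \<in> {1..n}"
  shows "b l = 0"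
proof
  fix \<psi>
  have "0 = slice \<alpha> \<psi> (\<Sum>l\<in>{1..n}. a l \<otimes>\<^sub>t b l)"
    unfolding 0 by (simp only: linear_0[OF linear_slice])
  also have "\<dots> = (\<Sum>l\<in>{1..n}. b l \<psi> *\<^sub>R a l)"
    unfolding linear_sum[OF linear_slice]
    by (intro sum.cong refl slice_times[OF local_a local_b disj])
  finally have "b l \<psi> = 0"
    by (intro basis_family_coeff_zero[OF basis _ l]) (rule sym)
  then show "b l \<psi> = 0 \<psi>" by simp
qed

text \<open>The slices over \<open>\<beta>\<close> are linear combinations of the \<open>b l\<close>.  For the converse let \<open>\<pi>\<close>
  be a projector onto the slice space; applied to the factor \<open>\<beta>\<close> it fixes the sum, so that
  \<open>\<Sum>l. a l \<otimes> (b l - \<pi> (b l)) = 0\<close>, and independence of the \<open>a l\<close> gives \<open>b l = \<pi> (b l)\<close>.\<close>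

lemma slice_space_cofactors:
  assumes local_b: "\<And>l. l \<in> {1..n} \<Longrightarrow> local_on \<beta> (b l)"
  shows "slice_space \<beta> (\<Sum>l\<in>{1..n}. a l \<otimes>\<^sub>t b l) = span (b ` {1..n})" (is "slice_space \<beta> ?v = _")
proof
  show "slice_space \<beta> ?v \<subseteq> span (b ` {1..n})"
  proof (rule slice_space_subset)
    fix \<psi>
    have "slice \<beta> \<psi> ?v = (\<Sum>l\<in>{1..n}. a l \<psi> *\<^sub>R b l)"
      unfolding linear_sum[OF linear_slice]
      by (intro sum.cong refl slice_times_right[OF local_a local_b disj])
    also have "\<dots> \<in> span (b ` {1..n})"
      by (intro span_sum span_scale span_base imageI)
    finally show "slice \<beta> \<psi> ?v \<in> span (b ` {1..n})" .
  qed simp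
  obtain \<pi> where \<pi>: "linear \<pi>" "\<And>x. \<pi> x \<in> slice_space \<beta> ?v" "\<And>x. x \<in> slice_space \<beta> ?v \<Longrightarrow> \<pi> x = x"
    by (rule ex_projector[OF subspace_slice_space]) blast
  have "?v = apply_on \<beta> \<pi> ?v"
    by (rule apply_on_fixed[symmetric]) (simp add: \<pi>(3) slice_in_slice_space)
  also have "\<dots> = (\<Sum>l\<in>{1..n}. a l \<otimes>\<^sub>t \<pi> (b l))"
    unfolding linear_sum[OF linear_apply_on[OF \<pi>(1)]]
  proof (intro sum.cong refl)
    fix l assume l: "l \<in> {1..n}"
    show "apply_on \<beta> \<pi> (a l \<otimes>\<^sub>t b l) = a l \<otimes>\<^sub>t \<pi> (b l)"
      unfolding tensor_times_commute[of "a l"]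
      by (rule apply_on_times[OF \<pi>(1) local_b[OF l] local_a[OF l]]) (use disj in blast)
  qed
  finally have 0: "(\<Sum>l\<in>{1..n}. a l \<otimes>\<^sub>t (b l - \<pi> (b l))) = 0"
    unfolding tensor_times_diff_right sum_subtractf by (simp only: right_minus_eq)
  have "b l \<in> slice_space \<beta> ?v" if l: "l \<in> {1..n}" for l
  proof -
    have loc: "local_on \<beta> (b l - \<pi> (b l))" if "l \<in> {1..n}" for l
      using local_b[OF that] local_on_slice_space[OF \<pi>(2)[of "b l"]]
      unfolding local_on_def minus_apply by metis
    have "b l - \<pi> (b l) = 0"
      by (rule tensor_times_sum_eq_0[OF loc 0 l])
    then have "b l = \<pi> (b l)" by (simp only: right_minus_eq)
    then show ?thesis using \<pi>(2)[of "b l"] by (simp only:)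
  qed
  then show "span (b ` {1..n}) \<subseteq> slice_space \<beta> ?v"
    by (intro span_minimal) auto
qed

end

section \<open>Expansions in products of bases\<close>

lemma finite_multi_indices: "finite P \<Longrightarrow> finite (multi_indices P r)"
  unfolding multi_indices_def by (intro finite_PiE) auto

lemma multi_indices_insert:
  "i \<in> multi_indices P r \<Longrightarrow> l \<in> {1..r \<beta>} \<Longrightarrow> i(\<beta> := l) \<in> multi_indices (insert \<beta> P) r"
  unfolding multi_indices_def by (rule PiE_fun_upd)

lemma multi_indices_insertE:
  assumes "i \<in> multi_indices (insert \<beta> P) r"
  obtains j l where "i = j(\<beta> := l)" "l \<in> {1..r \<beta>}" "j \<in> multi_indices P r"
proof -
  have "i \<in> (\<lambda>p. (snd p)(\<beta> := fst p)) ` ({1..r \<beta>} \<times> multi_indices P r)"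
    using assms unfolding multi_indices_def PiE_insert_eq case_prod_unfold .
  then obtain p where "i = (snd p)(\<beta> := fst p)" "p \<in> {1..r \<beta>} \<times> multi_indices P r"
    by (rule imageE)
  then show ?thesis by (intro that[of "snd p" "fst p"]) (simp_all only: mem_Times_iff)
qed

lemma block_Int_Union:
  assumes "disjoint P" "\<beta> \<in> P" "Q \<subseteq> P - {\<beta>}"
  shows "\<beta> \<inter> \<Union>Q = {}"
proof -
  have "\<beta> \<inter> \<gamma> = {}" if "\<gamma> \<in> Q" for \<gamma>
    using that assms by (intro disjointD[OF assms(1,2)]) auto
  then show ?thesis by auto
qed

lemma sum_multi_indices_insert:
  assumes "\<beta> \<notin> P"
  shows "(\<Sum>i\<in>multi_indices (insert \<beta> P) r. f i) =
    (\<Sum>l\<in>{1..r \<beta>}. \<Sum>i\<in>multi_indices P r. f (i(\<beta> := l)))"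
  unfolding multi_indices_def PiE_insert_eq sum.cartesian_product
  by (subst sum.reindex[OF inj_combinator[OF assms]]) (auto intro: sum.cong)

text \<open>Grouping the terms by the index in direction \<open>\<beta>\<close>.  The inner sums are the cofactor tensors; the
  lemma also drives the induction for independence of products of bases.\<close>

lemma tensor_prod_expansion_insert:
  assumes "finite P" "\<beta> \<notin> P"
  shows "(\<Sum>i\<in>multi_indices (insert \<beta> P) r. c i *\<^sub>R tensor_prod (insert \<beta> P) (\<lambda>\<delta>. u \<delta> (i \<delta>))) =
    (\<Sum>l\<in>{1..r \<beta>}. u \<beta> l \<otimes>\<^sub>t
      (\<Sum>i\<in>multi_indices P r. c (i(\<beta> := l)) *\<^sub>R tensor_prod P (\<lambda>\<delta>. u \<delta> (i \<delta>))))"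
proof -
  have "tensor_prod P (\<lambda>\<delta>. u \<delta> ((i(\<beta> := l)) \<delta>)) = tensor_prod P (\<lambda>\<delta>. u \<delta> (i \<delta>))" for i l
    using assms(2) unfolding tensor_prod_def by (intro ext prod.cong) auto
  then show ?thesis
    unfolding sum_multi_indices_insert[OF assms(2)] tensor_times_sum_right tensor_times_scaleR_right
      tensor_prod_insert[OF assms] by (simp only: fun_upd_same)
qed

context
  fixes P :: "'i set set" and r :: "'i set \<Rightarrow> nat"
    and u :: "'i set \<Rightarrow> nat \<Rightarrow> ('i, 'a::real_vector) tensor"
    and U :: "'i set \<Rightarrow> ('i, 'a) tensor set"
  assumes fin: "finite P" and disj: "disjoint P"
    and basis: "\<And>\<beta>. \<beta> \<in> P \<Longrightarrow> basis_family (r \<beta>) (u \<beta>) (U \<beta>)"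
    and loc: "\<And>\<beta> t. \<beta> \<in> P \<Longrightarrow> t \<in> U \<beta> \<Longrightarrow> local_on \<beta> t"
begin

lemma local_on_expansion:
  assumes "Q \<subseteq> P"
  shows "local_on (\<Union>Q) (\<Sum>i\<in>multi_indices Q r. c i *\<^sub>R tensor_prod Q (\<lambda>\<delta>. u \<delta> (i \<delta>)))"
proof (intro local_on_sum_scaleR local_on_tensor_prod)
  fix i \<beta> assume "i \<in> multi_indices Q r" "\<beta> \<in> Q"
  then have "i \<beta> \<in> {1..r \<beta>}" "\<beta> \<in> P" using assms unfolding multi_indices_def by auto
  then show "local_on \<beta> (u \<beta> (i \<beta>))" by (intro loc basis_family_mem[OF basis])
qed

text \<open>Induction on the number of factors: splitting off one factor leaves a sum of products with
  independent left factors, whose right factors are therefore shorter expansions of \<open>0\<close>.\<close>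

lemma tensor_prod_coeff_zero:
  assumes "(\<Sum>i\<in>multi_indices P r. c i *\<^sub>R tensor_prod P (\<lambda>\<beta>. u \<beta> (i \<beta>))) = 0"
    and "i \<in> multi_indices P r"
  shows "c i = 0"
proof -
  have "c i = 0"
    if "Q \<subseteq> P" "(\<Sum>i\<in>multi_indices Q r. c i *\<^sub>R tensor_prod Q (\<lambda>\<beta>. u \<beta> (i \<beta>))) = 0"
      "i \<in> multi_indices Q r" for Q c i
    using finite_subset[OF that(1) fin] that
  proof (induction Q arbitrary: c i rule: finite_induct)
    case empty
    have "multi_indices {} r = {i}" using empty(3) by (simp add: multi_indices_def)
    then have "c i *\<^sub>R tensor_prod {} (\<lambda>\<beta>. u \<beta> (i \<beta>)) = 0"
      using empty(2) by (simp only: sum.insert[OF finite.emptyI] sum.empty add_0_right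
          empty_iff not_False_eq_True)
    \<comment> \<open>The empty product is the constant function \<open>1\<close>; any argument will do.\<close>
    then have "(c i *\<^sub>R tensor_prod {} (\<lambda>\<beta>. u \<beta> (i \<beta>))) undefined = 0" by (simp only: zero_fun_apply)
    then show ?case by (simp add: scaleR_fun_apply tensor_prod_def)
  next
    case (insert \<beta> Q)
    have \<beta>: "\<beta> \<in> P" and Q: "Q \<subseteq> P" using insert.prems(1) by auto
    define b where "b l = (\<Sum>i\<in>multi_indices Q r. c (i(\<beta> := l)) *\<^sub>R tensor_prod Q (\<lambda>\<delta>. u \<delta> (i \<delta>)))" for l
    have 0: "(\<Sum>l\<in>{1..r \<beta>}. u \<beta> l \<otimes>\<^sub>t b l) = 0"
      unfolding b_def tensor_prod_expansion_insert[OF insert.hyps, symmetric] by (rule insert.prems(2))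
    obtain l j where i: "i = j(\<beta> := l)" "l \<in> {1..r \<beta>}" "j \<in> multi_indices Q r"
      by (rule multi_indices_insertE[OF insert.prems(3)])
    have loc_u: "local_on \<beta> (u \<beta> l)" if "l \<in> {1..r \<beta>}" for l
      by (rule loc[OF \<beta> basis_family_mem[OF basis[OF \<beta>] that]])
    have loc_b: "local_on (\<Union>Q) (b l)" for l
      unfolding b_def by (rule local_on_expansion[OF Q])
    have "\<beta> \<inter> \<Union>Q = {}"
      using Q insert.hyps(2)
      by (intro block_Int_Union[OF disj \<beta>]) (rule subset_Diff_insert[THEN iffD2], simp)
    then have "b l = 0"
      by (rule tensor_times_sum_eq_0[OF _ basis[OF \<beta>] loc_u loc_b 0 i(2)])
    then have "c (j(\<beta> := l)) = 0"
      using i(3) unfolding b_def by (rule insert.IH[OF Q])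
    then show ?case by (simp only: i(1))
  qed
  from this[OF order_refl assms] show ?thesis .
qed

lemma mem_tensor_prod_subspaces_expansion:
  assumes "t \<in> tensor_prod_subspaces P U"
  shows "\<exists>c. t = (\<Sum>i\<in>multi_indices P r. c i *\<^sub>R tensor_prod P (\<lambda>\<beta>. u \<beta> (i \<beta>)))"
proof (rule mem_span_image[OF finite_multi_indices[OF fin]])
  let ?B = "(\<lambda>i. tensor_prod P (\<lambda>\<beta>. u \<beta> (i \<beta>))) ` multi_indices P r"
  have "tensor_prod P s \<in> span ?B" if s: "\<forall>\<beta>\<in>P. s \<beta> \<in> U \<beta>" for s
  proof -
    have "tensor_prod P s \<in> span {tensor_prod P e | e. \<forall>\<beta>\<in>P. e \<beta> \<in> u \<beta> ` {1..r \<beta>}}"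
    proof (rule tensor_prod_span[OF fin])
      fix \<beta> assume "\<beta> \<in> P"
      then show "s \<beta> \<in> span (u \<beta> ` {1..r \<beta>})"
        using s basis unfolding basis_family_def by blast
    qed
    also have "\<dots> \<subseteq> span ?B"
    proof (intro span_mono subsetI)
      fix x assume "x \<in> {tensor_prod P e | e. \<forall>\<beta>\<in>P. e \<beta> \<in> u \<beta> ` {1..r \<beta>}}"
      then obtain e where e: "x = tensor_prod P e" "\<forall>\<beta>\<in>P. e \<beta> \<in> u \<beta> ` {1..r \<beta>}" by blast
      from e(2) have "\<forall>\<beta>\<in>P. \<exists>l. l \<in> {1..r \<beta>} \<and> e \<beta> = u \<beta> l" by blast
      from bchoice[OF this] obtain i where i: "\<forall>\<beta>\<in>P. i \<beta> \<in> {1..r \<beta>} \<and> e \<beta> = u \<beta> (i \<beta>)" ..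
      have "x = tensor_prod P (\<lambda>\<beta>. u \<beta> (restrict i P \<beta>))"
        unfolding e(1) tensor_prod_def using i by (intro ext prod.cong) auto
      moreover have "restrict i P \<in> multi_indices P r"
        using i unfolding multi_indices_def by auto
      ultimately show "x \<in> ?B" by blast
    qed
    finally show ?thesis .
  qed
  then have "tensor_prod_subspaces P U \<subseteq> span ?B"
    unfolding tensor_prod_subspaces_def by (intro span_minimal) auto
  then show "t \<in> span ?B" using assms by blast
qed

end

section \<open>Full rank of the coefficient tensors\<close>

text \<open>Independent rows number at most as many as there are columns, so the rank is automatically the
  minimum that the definition of full rank asks for.\<close>

lemma matrix_rank_eq_card_rows:
  assumes "finite I" "finite J"
    and indep: "\<And>c. (\<And>j. j \<in> J \<Longrightarrow> (\<Sum>k\<in>I. c k * M k j) = 0) \<Longrightarrow> \<forall>k\<in>I. c k = 0"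
  shows "matrix_rank I J M = min (card I) (card J)"
proof -
  define R where "R k = (\<lambda>j. if j \<in> J then M k j else 0)" for k
  have "inj_on R I \<and> independent (R ` I)"
    unfolding independent_family_iff[OF assms(1)]
  proof (intro allI impI)
    fix c assume 0: "(\<Sum>k\<in>I. c k *\<^sub>R R k) = 0"
    show "\<forall>k\<in>I. c k = 0"
    proof (rule indep)
      fix j assume j: "j \<in> J"
      have "(\<Sum>k\<in>I. c k * M k j) = (\<Sum>k\<in>I. c k *\<^sub>R R k) j"
        using j by (simp add: sum_fun_apply scaleR_fun_apply R_def)
      then show "(\<Sum>k\<in>I. c k * M k j) = 0" unfolding 0 by simp
    qed
  qed
  then have R: "inj_on R I" "independent (R ` I)" by auto
  have "R k \<in> span ((\<lambda>j x. if x = j then 1 else 0) ` J)" for k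
  proof -
    have "R k = (\<Sum>j\<in>J. M k j *\<^sub>R (\<lambda>x. if x = j then 1 else 0))"
      using assms(2) by (auto simp: fun_eq_iff sum_fun_apply scaleR_fun_apply R_def if_distrib cong: if_cong)
    also have "\<dots> \<in> span ((\<lambda>j x. if x = j then 1 else 0) ` J)"
      by (intro span_sum span_scale span_base) (rule imageI)
    finally show ?thesis .
  qed
  then have "card (R ` I) \<le> card ((\<lambda>j x. if x = j then 1 else 0 :: real) ` J)"
    using assms(2) by (intro independent_span_bound[OF _ R(2), THEN conjunct2]) auto
  also have "\<dots> \<le> card J" by (rule card_image_le[OF assms(2)])
  finally have "card I \<le> card J" by (simp add: card_image[OF R(1)])
  moreover have "matrix_rank I J M = card I"
    unfolding matrix_rank_def R_def[symmetric] using dim_eq_card_independent[OF R(2)] card_image[OF R(1)]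
    by simp
  ultimately show ?thesis by simp
qed


text \<open>Only independence of the rows has to be shown in each direction.  In direction \<open>\<mu>\<close> it is
  inherited from the \<open>u \<mu> k\<close>.  In the direction of \<open>\<nu> \<in> P\<close>, coefficients \<open>c l\<close> of a relation between the
  rows define a functional \<open>g\<close> with \<open>g (u \<nu> l) = c l\<close>; the relation says that \<open>g\<close> kills all slices
  over \<open>\<nu>\<close> of the \<open>u \<mu> k\<close>, and by \<open>minimal\<close> these span a space that contains the \<open>u \<nu> l\<close>.\<close>

lemma full_rank_transfer_tensor:
  fixes P :: "'i set set" and u :: "'i set \<Rightarrow> nat \<Rightarrow> ('i, 'a::real_vector) tensor"
  assumes fin: "finite P" and disj: "disjoint P" and \<mu>: "\<mu> \<notin> P"
    and basis: "\<And>\<beta>. \<beta> \<in> insert \<mu> P \<Longrightarrow> basis_family (r \<beta>) (u \<beta>) (U \<beta>)"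
    and loc: "\<And>\<beta> t. \<beta> \<in> P \<Longrightarrow> t \<in> U \<beta> \<Longrightarrow> local_on \<beta> t"
    and C: "C \<in> extensional (multi_indices (insert \<mu> P) r)"
    and expansion: "\<And>k. k \<in> {1..r \<mu>} \<Longrightarrow>
      u \<mu> k = (\<Sum>i\<in>multi_indices P r. C (i(\<mu> := k)) *\<^sub>R tensor_prod P (\<lambda>\<beta>. u \<beta> (i \<beta>)))"
    and minimal: "\<And>\<beta>. \<beta> \<in> P \<Longrightarrow> U \<beta> \<subseteq> span (\<Union>k\<in>{1..r \<mu>}. slice_space \<beta> (u \<mu> k))"
  shows "C \<in> full_rank_coeffs (insert \<mu> P) r"
proof -
  have "matrix_rank {1..r \<nu>} (multi_indices (insert \<mu> P - {\<nu>}) r) (matricization (insert \<mu> P) r \<nu> C) =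
      min (card {1..r \<nu>}) (card (multi_indices (insert \<mu> P - {\<nu>}) r))" if \<nu>: "\<nu> \<in> insert \<mu> P" for \<nu>
  proof (rule matrix_rank_eq_card_rows)
    fix c
    assume *: "\<And>i. i \<in> multi_indices (insert \<mu> P - {\<nu>}) r \<Longrightarrow>
      (\<Sum>l\<in>{1..r \<nu>}. c l * matricization (insert \<mu> P) r \<nu> C l i) = 0"
    have c: "(\<Sum>l\<in>{1..r \<nu>}. c l * C (i(\<nu> := l))) = 0"
      if "i \<in> multi_indices (insert \<mu> P - {\<nu>}) r" for i
    proof -
      have "(\<Sum>l\<in>{1..r \<nu>}. c l * C (i(\<nu> := l))) =
          (\<Sum>l\<in>{1..r \<nu>}. c l * matricization (insert \<mu> P) r \<nu> C l i)"
        using that by (intro sum.cong) (auto simp: matricization_def)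
      then show ?thesis using *[OF that] by simp
    qed
    show "\<forall>l\<in>{1..r \<nu>}. c l = 0"
    proof (cases "\<nu> = \<mu>")
      case True
      have ins: "insert \<mu> P - {\<mu>} = P" using \<mu> by blast
      have "(\<Sum>k\<in>{1..r \<mu>}. c k *\<^sub>R u \<mu> k) =
          (\<Sum>i\<in>multi_indices P r. (\<Sum>k\<in>{1..r \<mu>}. c k * C (i(\<mu> := k))) *\<^sub>R tensor_prod P (\<lambda>\<beta>. u \<beta> (i \<beta>)))"
        unfolding scaleR_sum_left
        by (subst sum.swap) (simp add: expansion scaleR_sum_right)
      also have "\<dots> = 0"
        by (intro sum.neutral ballI) (simp only: c[unfolded True ins] scaleR_zero_left)
      finally show ?thesis
        unfolding True by (intro ballI basis_family_coeff_zero[OF basis[OF insertI1]])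
    next
      case False
      then have \<nu>P: "\<nu> \<in> P" using \<nu> by simp
      define Q where "Q = P - {\<nu>}"
      have PQ: "P = insert \<nu> Q" "\<nu> \<notin> Q" "finite Q" "Q \<subseteq> P"
        using \<nu>P fin unfolding Q_def by auto
      have ins: "insert \<mu> P - {\<nu>} = insert \<mu> Q" using False unfolding Q_def by blast
      note b\<nu> = basis[OF \<nu>]
      have inj: "inj_on (u \<nu>) {1..r \<nu>}" and ind: "independent (u \<nu> ` {1..r \<nu>})"
        using b\<nu> unfolding basis_family_def by auto
      obtain g where g: "linear g"
        "\<forall>x\<in>u \<nu> ` {1..r \<nu>}. g x = c (the_inv_into {1..r \<nu>} (u \<nu>) x)"
        using linear_independent_extend[OF ind, of "\<lambda>x. c (the_inv_into {1..r \<nu>} (u \<nu>) x)"] by blast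
      have gu: "g (u \<nu> l) = c l" if "l \<in> {1..r \<nu>}" for l
        using bspec[OF g(2) imageI[OF that]] by (simp only: the_inv_into_f_f[OF inj that])
      have g0: "g x = 0" if k: "k \<in> {1..r \<mu>}" and x: "x \<in> slice_space \<nu> (u \<mu> k)" for k x
      proof -
        have g_slice: "g (slice \<nu> \<psi> (u \<mu> k)) = 0" for \<psi>
        proof -
          define W where "W l = (\<Sum>i\<in>multi_indices Q r.
            C (i(\<nu> := l, \<mu> := k)) *\<^sub>R tensor_prod Q (\<lambda>\<delta>. u \<delta> (i \<delta>)))" for l
          have u\<mu>: "u \<mu> k = (\<Sum>l\<in>{1..r \<nu>}. u \<nu> l \<otimes>\<^sub>t W l)"
            unfolding expansion[OF k] PQ(1) W_def
            by (rule tensor_prod_expansion_insert[OF PQ(3,2), where c = "\<lambda>i. C (i(\<mu> := k))"])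
          have loc\<nu>: "local_on \<nu> (u \<nu> l)" if "l \<in> {1..r \<nu>}" for l
            by (rule loc[OF \<nu>P basis_family_mem[OF b\<nu> that]])
          have locW: "local_on (\<Union>Q) (W l)" for l
            unfolding W_def using fin disj basis loc PQ(4)
            by (intro local_on_expansion[where P = P and U = U]) auto
          have dj: "\<nu> \<inter> \<Union>Q = {}" unfolding Q_def by (rule block_Int_Union[OF disj \<nu>P order_refl])
          have "slice \<nu> \<psi> (u \<mu> k) = (\<Sum>l\<in>{1..r \<nu>}. W l \<psi> *\<^sub>R u \<nu> l)"
            unfolding u\<mu> linear_sum[OF linear_slice]
            by (intro sum.cong refl slice_times[OF loc\<nu> locW dj])
          then have "g (slice \<nu> \<psi> (u \<mu> k)) = (\<Sum>l\<in>{1..r \<nu>}. W l \<psi> * c l)"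
            using gu by (simp add: linear_sum[OF g(1)] linear_scale[OF g(1)])
          also have "\<dots> = (\<Sum>i\<in>multi_indices Q r.
              (\<Sum>l\<in>{1..r \<nu>}. c l * C (i(\<nu> := l, \<mu> := k))) * tensor_prod Q (\<lambda>\<delta>. u \<delta> (i \<delta>)) \<psi>)"
            unfolding W_def sum_fun_apply scaleR_fun_apply sum_distrib_right
            by (subst sum.swap) (simp add: mult_ac)
          also have "\<dots> = 0"
          proof (rule sum.neutral, rule ballI)
            fix i assume "i \<in> multi_indices Q r"
            then have "i(\<mu> := k) \<in> multi_indices (insert \<mu> P - {\<nu>}) r"
              unfolding ins using k by (rule multi_indices_insert)
            from c[OF this] show "(\<Sum>l\<in>{1..r \<nu>}. c l * C (i(\<nu> := l, \<mu> := k))) *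
                tensor_prod Q (\<lambda>\<delta>. u \<delta> (i \<delta>)) \<psi> = 0"
              by (simp add: fun_upd_twist[OF False])
          qed
          finally show ?thesis .
        qed
        show ?thesis
          by (rule linear_eq_0_on_span[OF g(1) _ x[unfolded slice_space_def]])
            (elim rangeE, simp only: g_slice)
      qed
      show ?thesis
      proof
        fix l assume l: "l \<in> {1..r \<nu>}"
        have "u \<nu> l \<in> span (\<Union>k\<in>{1..r \<mu>}. slice_space \<nu> (u \<mu> k))"
          using minimal[OF \<nu>P] basis_family_mem[OF b\<nu> l] by blast
        then have "g (u \<nu> l) = 0"
          by (rule linear_eq_0_on_span[OF g(1), rotated]) (elim UN_E, rule g0)
        then show "c l = 0" using gu[OF l] by simp
      qed
    qed
  qed (use fin in \<open>auto intro: finite_multi_indices\<close>)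
  then show ?thesis using C unfolding full_rank_coeffs_def by blast
qed

section \<open>Tensors on a dimension partition tree\<close>

locale tensor_on_tree =
  fixes D :: "'i set" and V :: "'i \<Rightarrow> 'a::real_vector set"
    and T :: "'i set set" and S :: "'i set \<Rightarrow> 'i set set" and v :: "('i, 'a) tensor"
  assumes finite_D: "finite D"
    and tree: "dimension_partition_tree D T S"
    and v: "v \<in> tensor_space V D"
begin

lemma root: "D \<in> T"
  using tree unfolding dimension_partition_tree_def rooted_tree_def by (elim conjE)

lemma vertex:
  assumes "\<alpha> \<in> T"
  shows "\<alpha> \<noteq> {}" "\<alpha> \<subseteq> D" "finite \<alpha>"
proof -
  have "\<forall>\<alpha>\<in>T. \<alpha> \<noteq> {} \<and> \<alpha> \<subseteq> D"
    using tree unfolding dimension_partition_tree_def by (elim conjE)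
  then show "\<alpha> \<noteq> {}" "\<alpha> \<subseteq> D" using assms by blast+
  then show "finite \<alpha>" using finite_D finite_subset by blast
qed

lemma sons:
  assumes "\<mu> \<in> T - leaves T S"
  shows "S \<mu> \<subseteq> T - {D}" "partition_on \<mu> (S \<mu>)" "2 \<le> card (S \<mu>)"
proof -
  have \<mu>: "\<mu> \<in> T" "S \<mu> \<noteq> {}" using assms unfolding leaves_def by auto
  then show "S \<mu> \<subseteq> T - {D}"
    using tree unfolding dimension_partition_tree_def rooted_tree_def by (elim conjE) simp
  have "\<forall>\<alpha>\<in>T. card \<alpha> = 1 \<longrightarrow> S \<alpha> = {}"
    using tree unfolding dimension_partition_tree_def by (elim conjE)
  then have "card \<mu> \<noteq> 1" using \<mu> by blast
  moreover have "card \<mu> \<noteq> 0" using vertex[OF \<mu>(1)] by simp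
  ultimately have "2 \<le> card \<mu>" by linarith
  moreover have "\<forall>\<alpha>\<in>T. 2 \<le> card \<alpha> \<longrightarrow> 2 \<le> card (S \<alpha>) \<and> partition_on \<alpha> (S \<alpha>)"
    using tree unfolding dimension_partition_tree_def by (elim conjE)
  ultimately have "2 \<le> card (S \<mu>) \<and> partition_on \<mu> (S \<mu>)" using \<mu>(1) by simp
  then show "partition_on \<mu> (S \<mu>)" "2 \<le> card (S \<mu>)" by simp_all
qed

lemma sons_nonempty: "\<mu> \<in> T - leaves T S \<Longrightarrow> S \<mu> \<noteq> {}"
  using sons(3) by fastforce

lemma finite_sons: "\<mu> \<in> T - leaves T S \<Longrightarrow> finite (S \<mu>)"
  using sons(2) vertex(3) finite_elements by blast

lemma sons_disjoint: "\<mu> \<in> T - leaves T S \<Longrightarrow> disjoint (S \<mu>)"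
  using sons(2) partition_onD2 by blast

lemma son:
  assumes "\<mu> \<in> T - leaves T S" "\<beta> \<in> S \<mu>"
  shows "\<beta> \<in> T" "\<beta> \<subset> \<mu>" "\<Union>(S \<mu> - {\<beta>}) = \<mu> - \<beta>"
proof -
  note part = sons(2)[OF assms(1)]
  show "\<beta> \<in> T" using sons(1)[OF assms(1)] assms(2) by blast
  have dj: "\<gamma> \<inter> \<delta> = {}" if "\<gamma> \<in> S \<mu>" "\<delta> \<in> S \<mu>" "\<gamma> \<noteq> \<delta>" for \<gamma> \<delta>
    using part that unfolding partition_on_def disjoint_def by blast
  have un: "\<Union>(S \<mu>) = \<mu>" using part unfolding partition_on_def by blast
  show "\<Union>(S \<mu> - {\<beta>}) = \<mu> - \<beta>"
  proof
    show "\<Union>(S \<mu> - {\<beta>}) \<subseteq> \<mu> - \<beta>" using un dj[OF _ assms(2)] by blast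
    show "\<mu> - \<beta> \<subseteq> \<Union>(S \<mu> - {\<beta>})" using un by blast
  qed
  have "S \<mu> - {\<beta>} \<noteq> {}"
  proof
    assume "S \<mu> - {\<beta>} = {}"
    then have "card (S \<mu>) \<le> card {\<beta>}" by (intro card_mono) auto
    then show False using sons(3)[OF assms(1)] by simp
  qed
  then obtain \<gamma> where \<gamma>: "\<gamma> \<in> S \<mu>" "\<gamma> \<noteq> \<beta>" by blast
  then have "\<gamma> \<noteq> {}" "\<gamma> \<inter> \<beta> = {}" using part assms(2) dj unfolding partition_on_def by blast+
  then show "\<beta> \<subset> \<mu>" using un \<gamma> assms(2) by blast
qed

lemma vertex_not_son: "\<mu> \<in> T - leaves T S \<Longrightarrow> \<mu> \<notin> S \<mu>"
  using son(2) by blast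

lemma min_subspace_vertex: "\<alpha> \<in> T \<Longrightarrow> min_subspace V D \<alpha> v = slice_space \<alpha> v"
  using vertex by (intro min_subspace_eq_slice_space finite_D v) auto

lemma slice_space_vertex_subset: "\<alpha> \<in> T \<Longrightarrow> slice_space \<alpha> v \<subseteq> tensor_space V \<alpha>"
  by (rule slice_space_subset_tensor_space[OF finite_D _ v]) (rule vertex)

text \<open>An element \<open>w\<close> of the slice space over \<open>\<mu>\<close> lies in the product of its own slice spaces over the
  sons, and slices of \<open>w\<close> are combinations of slices of \<open>v\<close>.\<close>

lemma slice_space_sons:
  assumes \<mu>: "\<mu> \<in> T - leaves T S"
  shows "slice_space \<mu> v \<subseteq> tensor_prod_subspaces (S \<mu>) (\<lambda>\<beta>. slice_space \<beta> v)"
proof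
  fix w assume w: "w \<in> slice_space \<mu> v"
  have \<mu>T: "\<mu> \<in> T" using \<mu> by simp
  have "w \<in> tensor_prod_subspaces (S \<mu>) (tensor_space V)"
    unfolding tensor_prod_tensor_spaces[OF vertex(3)[OF \<mu>T] sons(2)[OF \<mu>]]
    using slice_space_vertex_subset[OF \<mu>T] w by blast
  then have w': "w \<in> tensor_prod_subspaces (S \<mu>) (\<lambda>\<beta>. slice_space \<beta> w)"
    by (rule mem_tensor_prod_slice_spaces[OF finite_sons[OF \<mu>] sons_disjoint[OF \<mu>]
          local_on_tensor_space, rotated])
  have sub: "slice_space \<beta> w \<subseteq> slice_space \<beta> v" if \<beta>: "\<beta> \<in> S \<mu>" for \<beta>
  proof -
    have "slice_space \<beta> v = span (\<Union>s\<in>slice_space \<mu> v. slice_space \<beta> s)"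
      using son(2)[OF \<mu> \<beta>]
      by (intro slice_space_nested) (auto simp: span_eq_iff[THEN iffD2, OF subspace_slice_space])
    moreover have "slice_space \<beta> w \<subseteq> \<dots>"
      using w by (intro order_trans[OF _ span_superset] UN_upper)
    ultimately show ?thesis by simp
  qed
  have "tensor_prod_subspaces (S \<mu>) (\<lambda>\<beta>. slice_space \<beta> w) \<subseteq>
      tensor_prod_subspaces (S \<mu>) (\<lambda>\<beta>. slice_space \<beta> v)"
    unfolding tensor_prod_subspaces_def using sub by (intro span_mono) blast
  with w' show "w \<in> tensor_prod_subspaces (S \<mu>) (\<lambda>\<beta>. slice_space \<beta> v)" by blast
qed

lemma slice_space_from_basis:
  assumes "basis_family n w (slice_space \<mu> v)" "\<beta> \<subseteq> \<mu>"
  shows "slice_space \<beta> v = span (\<Union>k\<in>{1..n}. slice_space \<beta> (w k))"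
proof -
  have "slice_space \<beta> v = span (\<Union>s\<in>w ` {1..n}. slice_space \<beta> s)"
    using assms unfolding basis_family_def by (intro slice_space_nested) auto
  then show ?thesis by (simp only: UN_simps(10))
qed

lemma transfer_tensor_unique:
  fixes u :: "'i set \<Rightarrow> nat \<Rightarrow> ('i, 'a) tensor"
  assumes \<mu>: "\<mu> \<in> T - leaves T S"
    and basis: "\<And>\<beta>. \<beta> \<in> S \<mu> \<Longrightarrow> basis_family (r \<beta>) (u \<beta>) (slice_space \<beta> v)"
    and C: "C \<in> extensional (multi_indices (insert \<mu> (S \<mu>)) r)"
      "C' \<in> extensional (multi_indices (insert \<mu> (S \<mu>)) r)"
    and eq: "\<And>k. k \<in> {1..r \<mu>} \<Longrightarrow> son_expansion S r u \<mu> C k = son_expansion S r u \<mu> C' k"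
  shows "C = C'"
proof (rule extensionalityI[OF C])
  fix j assume "j \<in> multi_indices (insert \<mu> (S \<mu>)) r"
  then obtain i k where j: "j = i(\<mu> := k)" "k \<in> {1..r \<mu>}" "i \<in> multi_indices (S \<mu>) r"
    by (rule multi_indices_insertE)
  have 0: "(\<Sum>i\<in>multi_indices (S \<mu>) r. (C (i(\<mu> := k)) - C' (i(\<mu> := k))) *\<^sub>R
      tensor_prod (S \<mu>) (\<lambda>\<beta>. u \<beta> (i \<beta>))) = 0"
    using eq[OF j(2)] unfolding son_expansion_def scaleR_left_diff_distrib sum_subtractf
    by (simp only: diff_self)
  have "C (i(\<mu> := k)) - C' (i(\<mu> := k)) = 0"
  proof (rule tensor_prod_coeff_zero[where c = "\<lambda>i. C (i(\<mu> := k)) - C' (i(\<mu> := k))",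
        OF finite_sons[OF \<mu>] sons_disjoint[OF \<mu>] _ _ 0 j(3)])
    show "basis_family (r \<beta>) (u \<beta>) (slice_space \<beta> v)" if "\<beta> \<in> S \<mu>" for \<beta>
      using that by (rule basis)
  qed (rule local_on_slice_space)
  then show "C j = C' j" unfolding j(1) by simp
qed

lemma ex_transfer_tensor:
  fixes u :: "'i set \<Rightarrow> nat \<Rightarrow> ('i, 'a) tensor"
  assumes \<mu>: "\<mu> \<in> T - leaves T S"
    and basis: "\<And>\<alpha>. \<alpha> \<in> T \<Longrightarrow> basis_family (r \<alpha>) (u \<alpha>) (slice_space \<alpha> v)"
  shows "\<exists>C\<in>full_rank_coeffs (insert \<mu> (S \<mu>)) r. \<forall>k\<in>{1..r \<mu>}. u \<mu> k = son_expansion S r u \<mu> C k"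
proof -
  have \<mu>T: "\<mu> \<in> T" using \<mu> by simp
  have sonT: "\<beta> \<in> T" if "\<beta> \<in> insert \<mu> (S \<mu>)" for \<beta> using that son(1)[OF \<mu>] \<mu>T by blast
  have "\<exists>c. u \<mu> k = (\<Sum>i\<in>multi_indices (S \<mu>) r. c i *\<^sub>R tensor_prod (S \<mu>) (\<lambda>\<beta>. u \<beta> (i \<beta>)))"
    if k: "k \<in> {1..r \<mu>}" for k
  proof (rule mem_tensor_prod_subspaces_expansion[OF finite_sons[OF \<mu>] sons_disjoint[OF \<mu>]])
    show "basis_family (r \<beta>) (u \<beta>) (slice_space \<beta> v)" if "\<beta> \<in> S \<mu>" for \<beta>
      using basis sonT that by blast
    show "u \<mu> k \<in> tensor_prod_subspaces (S \<mu>) (\<lambda>\<beta>. slice_space \<beta> v)"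
      using slice_space_sons[OF \<mu>] basis_family_mem[OF basis[OF \<mu>T] k] by blast
  qed (rule local_on_slice_space)
  then have "\<forall>k\<in>{1..r \<mu>}. \<exists>c.
      u \<mu> k = (\<Sum>i\<in>multi_indices (S \<mu>) r. c i *\<^sub>R tensor_prod (S \<mu>) (\<lambda>\<beta>. u \<beta> (i \<beta>)))"
    by (rule ballI)
  from bchoice[OF this] obtain c where c: "\<forall>k\<in>{1..r \<mu>}.
      u \<mu> k = (\<Sum>i\<in>multi_indices (S \<mu>) r. c k i *\<^sub>R tensor_prod (S \<mu>) (\<lambda>\<beta>. u \<beta> (i \<beta>)))" ..
  \<comment> \<open>A multi-index \<open>j\<close> splits into its entry at \<open>\<mu>\<close> and its entries at the sons.\<close>
  define C where "C = restrict (\<lambda>j. c (j \<mu>) (restrict j (S \<mu>))) (multi_indices (insert \<mu> (S \<mu>)) r)"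
  have C: "C (i(\<mu> := k)) = c k i" if "k \<in> {1..r \<mu>}" "i \<in> multi_indices (S \<mu>) r" for k i
  proof -
    have "restrict (i(\<mu> := k)) (S \<mu>) = i"
      using that(2) vertex_not_son[OF \<mu>] unfolding multi_indices_def
      by (intro ext) (auto simp: PiE_def extensional_def)
    then show ?thesis unfolding C_def using multi_indices_insert[OF that(2,1)] by simp
  qed
  have ext: "C \<in> extensional (multi_indices (insert \<mu> (S \<mu>)) r)"
    unfolding C_def by (rule restrict_extensional)
  have expansion: "u \<mu> k = (\<Sum>i\<in>multi_indices (S \<mu>) r. C (i(\<mu> := k)) *\<^sub>R
      tensor_prod (S \<mu>) (\<lambda>\<beta>. u \<beta> (i \<beta>)))" if k: "k \<in> {1..r \<mu>}" for k
    by (rule trans[OF bspec[OF c k]]) (intro sum.cong refl, simp only: C[OF k])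
  have "C \<in> full_rank_coeffs (insert \<mu> (S \<mu>)) r"
  proof (rule full_rank_transfer_tensor[where U = "\<lambda>\<beta>. slice_space \<beta> v",
        OF finite_sons[OF \<mu>] sons_disjoint[OF \<mu>] vertex_not_son[OF \<mu>] basis[OF sonT]
          local_on_slice_space ext expansion])
    show "slice_space \<beta> v \<subseteq> span (\<Union>k\<in>{1..r \<mu>}. slice_space \<beta> (u \<mu> k))" if "\<beta> \<in> S \<mu>" for \<beta>
      using slice_space_from_basis[OF basis[OF \<mu>T], of \<beta>] son(2)[OF \<mu> that] by blast
  qed
  then show ?thesis unfolding son_expansion_def by (intro bexI[of _ C] ballI expansion)
qed

lemma slice_space_root: "slice_space D v = span {v}"
  by (rule slice_space_total[OF local_on_tensor_space[OF v]])

text \<open>If the root has sons and \<open>v \<noteq> 0\<close>, then the basis at the root has to be \<open>v\<close> itself, since the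
  last clause of \<open>tree_representation\<close> gives \<open>v\<close> and \<open>u D 1\<close> the same expansion;
  \<open>\<lambda>_. v\<close> serves for both possible ranks \<open>0\<close> and \<open>1\<close> of the root.  For \<open>v = 0\<close> the index \<open>1\<close> in
  that clause is out of range, but then the ranks of the sons are \<open>0\<close> and the expansion is an empty
  sum.\<close>

lemma ex_tree_representation:
  assumes "v \<in> fixed_rank_tensors V D T r"
  shows "\<exists>u C. tree_representation V D T S r v u C"
proof -
  have dim: "dim (slice_space \<alpha> v) = r \<alpha>" if "\<alpha> \<in> T" for \<alpha>
    using assms min_subspace_vertex[OF that] that unfolding fixed_rank_tensors_def by auto
  have "\<exists>w. basis_family (r \<alpha>) w (slice_space \<alpha> v) \<and> (\<alpha> = D \<longrightarrow> w = (\<lambda>_. v))" if \<alpha>: "\<alpha> \<in> T" for \<alpha>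
  proof (cases "\<alpha> = D")
    case True
    have "basis_family (dim (span {v})) (\<lambda>_. v) (span {v})"
    proof (cases "v = 0")
      case True
      have "dim (span {v}) = 0"
        using dim_eq_card_independent[OF independent_empty]
        by (simp only: True span_insert_0 dim_span card.empty)
      then show ?thesis
        unfolding True span_insert_0 by (simp add: basis_family_def independent_empty)
    next
      case False
      then have "independent {v}" by (simp only: dependent_single not_False_eq_True)
      then show ?thesis
        using dim_eq_card_independent[of "{v}"] by (simp add: basis_family_def dim_span)
    qed
    then show ?thesis
      using dim[OF \<alpha>] unfolding True slice_space_root by (intro exI[of _ "\<lambda>_. v"]) simp
  next
    case False
    obtain F where "finite F" "slice_space \<alpha> v \<subseteq> span F"
      using slice_space_finite[OF finite_D vertex(2)[OF \<alpha>] v] by blast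
    then obtain w where "basis_family (r \<alpha>) w (slice_space \<alpha> v)"
      using ex_basis_family[OF subspace_slice_space] unfolding dim[OF \<alpha>, symmetric] by blast
    then show ?thesis using False by blast
  qed
  then have "\<forall>\<alpha>\<in>T. \<exists>w. basis_family (r \<alpha>) w (slice_space \<alpha> v) \<and> (\<alpha> = D \<longrightarrow> w = (\<lambda>_. v))" by blast
  from bchoice[OF this] obtain u where
    u: "\<forall>\<alpha>\<in>T. basis_family (r \<alpha>) (u \<alpha>) (slice_space \<alpha> v) \<and> (\<alpha> = D \<longrightarrow> u \<alpha> = (\<lambda>_. v))" ..
  then have basis: "basis_family (r \<alpha>) (u \<alpha>) (slice_space \<alpha> v)" if "\<alpha> \<in> T" for \<alpha>
    using that by blast
  have uD: "u D k = v" for k using u root by simp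
  have "\<forall>\<mu>\<in>T - leaves T S. \<exists>C. C \<in> full_rank_coeffs (insert \<mu> (S \<mu>)) r \<and>
      (\<forall>k\<in>{1..r \<mu>}. u \<mu> k = son_expansion S r u \<mu> C k)"
    using ex_transfer_tensor[OF _ basis] by blast
  from bchoice[OF this] obtain C where
    C: "\<And>\<mu>. \<mu> \<in> T - leaves T S \<Longrightarrow> C \<mu> \<in> full_rank_coeffs (insert \<mu> (S \<mu>)) r"
    and expansion: "\<And>\<mu> k. \<mu> \<in> T - leaves T S \<Longrightarrow> k \<in> {1..r \<mu>} \<Longrightarrow> u \<mu> k = son_expansion S r u \<mu> (C \<mu>) k"
    by blast
  have "v = son_expansion S r u D (C D) 1" if D: "D \<notin> leaves T S"
  proof (cases "v = 0")
    case True
    have DT: "D \<in> T - leaves T S" using root D by blast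
    then obtain \<beta> where \<beta>: "\<beta> \<in> S D" using sons_nonempty by blast
    have "slice_space \<beta> v \<subseteq> span {}"
      unfolding True by (intro slice_space_subset)
        (simp_all only: subspace_span linear_0[OF linear_slice] span_zero)
    then have "dim (slice_space \<beta> v) \<le> card ({} :: ('i, 'a) tensor set)"
      by (intro dim_le_card) auto
    then have "r \<beta> = 0" using dim son(1)[OF DT \<beta>] by simp
    then have "multi_indices (S D) r = {}"
      using \<beta> unfolding multi_indices_def
      by (intro PiE_eq_empty_iff[THEN iffD2] bexI[of _ \<beta>]) simp_all
    then show ?thesis unfolding son_expansion_def True by (simp only: sum.empty)
  next
    case False
    then have "independent {v}" by (simp only: dependent_single not_False_eq_True)
    then have "r D = 1"
      using dim[OF root] dim_eq_card_independent[of "{v}"]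
      unfolding slice_space_root dim_span by simp
    then show ?thesis using expansion[of D 1] uD D root by simp
  qed
  then have "tree_representation V D T S r v u C"
    unfolding tree_representation_def
  proof (intro conjI ballI impI)
    fix k assume "k \<in> leaves T S"
    then have "k \<in> T" unfolding leaves_def by blast
    then show "basis_family (r k) (u k) (min_subspace V D k v)"
      using basis min_subspace_vertex by simp
  next
    fix \<mu> C' assume \<mu>: "\<mu> \<in> T - leaves T S" and C': "C' \<in> full_rank_coeffs (insert \<mu> (S \<mu>)) r"
      and eq: "\<forall>k\<in>{1..r \<mu>}. u \<mu> k = son_expansion S r u \<mu> C' k"
    show "C' = C \<mu>"
    proof (rule transfer_tensor_unique[OF \<mu>, where u = u])
      show "C' \<in> extensional (multi_indices (insert \<mu> (S \<mu>)) r)"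
        "C \<mu> \<in> extensional (multi_indices (insert \<mu> (S \<mu>)) r)"
        using C' C[OF \<mu>] unfolding full_rank_coeffs_def by blast+
      show "basis_family (r \<beta>) (u \<beta>) (slice_space \<beta> v)" if "\<beta> \<in> S \<mu>" for \<beta>
        by (rule basis[OF son(1)[OF \<mu> that]])
      show "son_expansion S r u \<mu> C' k = son_expansion S r u \<mu> (C \<mu>) k" if "k \<in> {1..r \<mu>}" for k
        using bspec[OF eq that] expansion[OF \<mu> that] by (simp only:)
    qed
  qed (auto intro: C expansion basis simp: min_subspace_vertex)
  then show ?thesis by blast
qed

subsection \<open>Consequences of a tree-based representation\<close>

context
  fixes r u C
  assumes rep: "tree_representation V D T S r v u C"
begin

lemma representation_basis:
  assumes "\<alpha> \<in> T"
  shows "basis_family (r \<alpha>) (u \<alpha>) (slice_space \<alpha> v)"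
proof (cases "\<alpha> \<in> leaves T S")
  case True
  then show ?thesis
    using rep min_subspace_vertex[OF assms] unfolding tree_representation_def by (elim conjE) auto
next
  case False
  then show ?thesis
    using bspec[OF rep[unfolded tree_representation_def, THEN conjunct2, THEN conjunct1], of \<alpha>]
      assms min_subspace_vertex[OF assms] by simp
qed

lemma representation_fixed_rank: "v \<in> fixed_rank_tensors V D T r"
  unfolding fixed_rank_tensors_def
  using v basis_family_dim[OF representation_basis] by (auto simp: min_subspace_vertex)

lemma representation_expansion:
  "\<mu> \<in> T - leaves T S \<Longrightarrow> k \<in> {1..r \<mu>} \<Longrightarrow> u \<mu> k = son_expansion S r u \<mu> (C \<mu>) k"
  using rep unfolding tree_representation_def by (elim conjE) blast

lemma representation_root: "D \<notin> leaves T S \<Longrightarrow> v = son_expansion S r u D (C D) 1"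
  using rep unfolding tree_representation_def by (elim conjE) (erule mp)

lemma son_expansion_cofactors:
  assumes \<mu>: "\<mu> \<in> T - leaves T S" and \<beta>: "\<beta> \<in> S \<mu>"
  shows "son_expansion S r u \<mu> c k = (\<Sum>l\<in>{1..r \<beta>}. u \<beta> l \<otimes>\<^sub>t cofactor_tensor S r u \<mu> c \<beta> k l)"
proof -
  define Q where "Q = S \<mu> - {\<beta>}"
  have Q: "S \<mu> = insert \<beta> Q" "\<beta> \<notin> Q" "finite Q"
    using \<beta> finite_sons[OF \<mu>] unfolding Q_def by auto
  show ?thesis
    unfolding son_expansion_def cofactor_tensor_def Q_def[symmetric] unfolding Q(1)
    by (rule tensor_prod_expansion_insert[OF Q(3,2), where c = "\<lambda>i. c (i(\<mu> := k))"])
qed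

text \<open>This holds for arbitrary coefficients \<open>c\<close> and index \<open>k\<close>, so that it covers both the basis vectors
  \<open>u \<mu> k\<close> and \<open>v\<close>, whose expansion has the index \<open>1\<close> even when the rank of the root is \<open>0\<close>.\<close>

lemma slice_space_son_expansion:
  assumes \<mu>: "\<mu> \<in> T - leaves T S" and \<beta>: "\<beta> \<in> S \<mu>"
  shows "slice_space (\<mu> - \<beta>) (son_expansion S r u \<mu> c k) =
    span {cofactor_tensor S r u \<mu> c \<beta> k l | l. l \<in> {1..r \<beta>}}"
proof -
  note basis_\<beta> = representation_basis[OF son(1)[OF \<mu> \<beta>]]
  have "local_on (\<mu> - \<beta>) (cofactor_tensor S r u \<mu> c \<beta> k l)" for l
    unfolding cofactor_tensor_def son(3)[OF \<mu> \<beta>, symmetric]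
    by (rule local_on_expansion[OF finite_sons[OF \<mu>] sons_disjoint[OF \<mu>]
          representation_basis[OF son(1)[OF \<mu>]] local_on_slice_space Diff_subset])
  then have "slice_space (\<mu> - \<beta>) (son_expansion S r u \<mu> c k) =
      span (cofactor_tensor S r u \<mu> c \<beta> k ` {1..r \<beta>})"
    unfolding son_expansion_cofactors[OF \<mu> \<beta>]
    by (intro slice_space_cofactors[OF _ basis_\<beta>, of \<beta>] local_on_slice_space[of _ \<beta> v]
        basis_family_mem[OF basis_\<beta>]) auto
  then show ?thesis by (simp only: Setcompr_eq_image)
qed

text \<open>The minimal subspace of \<open>v\<close> over \<open>\<mu> - \<beta>\<close> is obtained from those of the basis vectors \<open>u \<mu> k\<close> since
  slices of slices are slices; each of the latter is the span of a row of cofactor tensors.\<close>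

lemma representation_cofactors:
  assumes \<mu>: "\<mu> \<in> T - leaves T S" and \<beta>: "\<beta> \<in> S \<mu>"
  shows "\<And>k. k \<in> {1..r \<mu>} \<Longrightarrow>
      u \<mu> k = (\<Sum>l\<in>{1..r \<beta>}. u \<beta> l \<otimes>\<^sub>t cofactor_tensor S r u \<mu> (C \<mu>) \<beta> k l)"
    and "\<And>k. k \<in> {1..r \<mu>} \<Longrightarrow> min_subspace V \<mu> (\<mu> - \<beta>) (u \<mu> k) =
      span {cofactor_tensor S r u \<mu> (C \<mu>) \<beta> k l | l. l \<in> {1..r \<beta>}}"
    and "min_subspace V D (\<mu> - \<beta>) v = span (\<Union>k\<in>{1..r \<mu>}. min_subspace V \<mu> (\<mu> - \<beta>) (u \<mu> k))"
    and "min_subspace V D (\<mu> - \<beta>) v =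
      span {cofactor_tensor S r u \<mu> (C \<mu>) \<beta> k l | k l. k \<in> {1..r \<mu>} \<and> l \<in> {1..r \<beta>}}"
proof -
  have \<mu>T: "\<mu> \<in> T" using \<mu> by simp
  note basis_\<mu> = representation_basis[OF \<mu>T]
  have ne: "\<mu> - \<beta> \<noteq> {}" and sub: "\<mu> - \<beta> \<subseteq> \<mu>" using son(2)[OF \<mu> \<beta>] by auto
  let ?W = "\<lambda>k. {cofactor_tensor S r u \<mu> (C \<mu>) \<beta> k l | l. l \<in> {1..r \<beta>}}"
  show "u \<mu> k = (\<Sum>l\<in>{1..r \<beta>}. u \<beta> l \<otimes>\<^sub>t cofactor_tensor S r u \<mu> (C \<mu>) \<beta> k l)"
    if k: "k \<in> {1..r \<mu>}" for k
    by (rule trans[OF representation_expansion[OF \<mu> k] son_expansion_cofactors[OF \<mu> \<beta>]])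
  have min_u: "min_subspace V \<mu> (\<mu> - \<beta>) (u \<mu> k) = slice_space (\<mu> - \<beta>) (u \<mu> k)"
    if k: "k \<in> {1..r \<mu>}" for k
    using slice_space_vertex_subset[OF \<mu>T] basis_family_mem[OF basis_\<mu> k]
    by (intro min_subspace_eq_slice_space vertex(3)[OF \<mu>T] sub ne) blast
  show cof: "min_subspace V \<mu> (\<mu> - \<beta>) (u \<mu> k) = span (?W k)" if k: "k \<in> {1..r \<mu>}" for k
    using slice_space_son_expansion[OF \<mu> \<beta>, of "C \<mu>" k]
    unfolding min_u[OF k] representation_expansion[OF \<mu> k, symmetric] .
  have "min_subspace V D (\<mu> - \<beta>) v = slice_space (\<mu> - \<beta>) v"
    using sub vertex(2)[OF \<mu>T] by (intro min_subspace_eq_slice_space finite_D ne v) blast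
  also have "\<dots> = span (\<Union>k\<in>{1..r \<mu>}. slice_space (\<mu> - \<beta>) (u \<mu> k))"
    by (rule slice_space_from_basis[OF basis_\<mu> sub])
  also have "\<dots> = span (\<Union>k\<in>{1..r \<mu>}. min_subspace V \<mu> (\<mu> - \<beta>) (u \<mu> k))"
    by (intro arg_cong[where f = span] SUP_cong refl) (simp only: min_u)
  finally show U: "min_subspace V D (\<mu> - \<beta>) v =
      span (\<Union>k\<in>{1..r \<mu>}. min_subspace V \<mu> (\<mu> - \<beta>) (u \<mu> k))" .
  also have "\<dots> = span (\<Union>k\<in>{1..r \<mu>}. span (?W k))"
    by (intro arg_cong[where f = span] SUP_cong refl) (simp only: cof)
  also have "\<dots> = span (\<Union>k\<in>{1..r \<mu>}. ?W k)"
  proof (rule subset_antisym)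
    show "span (\<Union>k\<in>{1..r \<mu>}. span (?W k)) \<subseteq> span (\<Union>k\<in>{1..r \<mu>}. ?W k)"
      by (intro span_minimal UN_least span_mono UN_upper subspace_span)
    show "span (\<Union>k\<in>{1..r \<mu>}. ?W k) \<subseteq> span (\<Union>k\<in>{1..r \<mu>}. span (?W k))"
      by (intro span_mono UN_mono order_refl span_superset)
  qed
  also have "(\<Union>k\<in>{1..r \<mu>}. ?W k) =
      {cofactor_tensor S r u \<mu> (C \<mu>) \<beta> k l | k l. k \<in> {1..r \<mu>} \<and> l \<in> {1..r \<beta>}}"
    by blast
  finally show "min_subspace V D (\<mu> - \<beta>) v =
      span {cofactor_tensor S r u \<mu> (C \<mu>) \<beta> k l | k l. k \<in> {1..r \<mu>} \<and> l \<in> {1..r \<beta>}}" .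
qed

lemma representation_root_cofactors:
  assumes \<alpha>: "\<alpha> \<in> S D"
  shows "v = (\<Sum>l\<in>{1..r \<alpha>}. u \<alpha> l \<otimes>\<^sub>t cofactor_tensor S r u D (C D) \<alpha> 1 l)"
    and "min_subspace V D (D - \<alpha>) v =
      span {cofactor_tensor S r u D (C D) \<alpha> 1 l | l. l \<in> {1..r \<alpha>}}"
proof -
  have D: "D \<in> T - leaves T S" using root \<alpha> unfolding leaves_def by blast
  have v_eq: "son_expansion S r u D (C D) 1 = v" using representation_root D by simp
  show "v = (\<Sum>l\<in>{1..r \<alpha>}. u \<alpha> l \<otimes>\<^sub>t cofactor_tensor S r u D (C D) \<alpha> 1 l)"
    using son_expansion_cofactors[OF D \<alpha>, of "C D" 1] unfolding v_eq .
  have "min_subspace V D (D - \<alpha>) v = slice_space (D - \<alpha>) v"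
    using son(2)[OF D \<alpha>] by (intro min_subspace_eq_slice_space finite_D v) auto
  then show "min_subspace V D (D - \<alpha>) v =
      span {cofactor_tensor S r u D (C D) \<alpha> 1 l | l. l \<in> {1..r \<alpha>}}"
    using slice_space_son_expansion[OF D \<alpha>, of "C D" 1] unfolding v_eq by (simp only:)
qed

end

end

theorem theorem2p19:
  fixes D :: "'i set" and V :: "'i \<Rightarrow> 'a::real_vector set"
    and T :: "'i set set" and S :: "'i set \<Rightarrow> 'i set set"
    and r :: "'i set \<Rightarrow> nat" and v :: "('i, 'a) tensor"
  assumes "finite D"
    and "\<And>j. j \<in> D \<Longrightarrow> subspace (V j)"
    and "dimension_partition_tree D T S"
    and "v \<in> tensor_space V D"
  shows "(v \<in> fixed_rank_tensors V D T r \<longleftrightarrow> (\<exists>u C. tree_representation V D T S r v u C)) \<and>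
    (v \<in> fixed_rank_tensors V D T r \<longrightarrow> (\<forall>u C. tree_representation V D T S r v u C \<longrightarrow>
      (\<forall>\<alpha>\<in>S D.
        v = (\<Sum>l\<in>{1..r \<alpha>}. u \<alpha> l \<otimes>\<^sub>t cofactor_tensor S r u D (C D) \<alpha> 1 l) \<and>
        min_subspace V D (D - \<alpha>) v =
          span {cofactor_tensor S r u D (C D) \<alpha> 1 l | l. l \<in> {1..r \<alpha>}}) \<and>
      (\<forall>\<mu>\<in>T - leaves T S. \<forall>\<beta>\<in>S \<mu>.
        (\<forall>k\<in>{1..r \<mu>}.
          u \<mu> k = (\<Sum>l\<in>{1..r \<beta>}. u \<beta> l \<otimes>\<^sub>t cofactor_tensor S r u \<mu> (C \<mu>) \<beta> k l) \<and>
          min_subspace V \<mu> (\<mu> - \<beta>) (u \<mu> k) =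
            span {cofactor_tensor S r u \<mu> (C \<mu>) \<beta> k l | l. l \<in> {1..r \<beta>}}) \<and>
        min_subspace V D (\<mu> - \<beta>) v =
          span (\<Union>k\<in>{1..r \<mu>}. min_subspace V \<mu> (\<mu> - \<beta>) (u \<mu> k)) \<and>
        min_subspace V D (\<mu> - \<beta>) v =
          span {cofactor_tensor S r u \<mu> (C \<mu>) \<beta> k l | k l. k \<in> {1..r \<mu>} \<and> l \<in> {1..r \<beta>}})))"
proof -
  interpret tensor_on_tree D V T S v
    by (rule tensor_on_tree.intro[OF assms(1,3,4)])
  show ?thesis (is "_ \<and> (_ \<longrightarrow> (\<forall>u C. _ \<longrightarrow> ?P u C))")
  proof (rule conjI, rule iffI)
    assume "v \<in> fixed_rank_tensors V D T r"
    then show "\<exists>u C. tree_representation V D T S r v u C" by (rule ex_tree_representation)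
  next
    assume "\<exists>u C. tree_representation V D T S r v u C"
    then show "v \<in> fixed_rank_tensors V D T r" by (elim exE) (rule representation_fixed_rank)
  next
    show "v \<in> fixed_rank_tensors V D T r \<longrightarrow> (\<forall>u C. tree_representation V D T S r v u C \<longrightarrow> ?P u C)"
    proof (rule impI, rule allI, rule allI, rule impI)
      fix u C assume rep: "tree_representation V D T S r v u C"
      show "?P u C"
        by (intro conjI ballI representation_root_cofactors[OF rep] representation_cofactors[OF rep])
    qed
  qed
qed

end
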